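(* Consider the fixed-design linear model $y_i=\boldsymbol\beta^\top\boldsymbol{x}_i+e_i$, $i=1,\dots,N$, with predetermined covariates $\boldsymbol{x}_i\in\mathbb{R}^d$ and independent error terms $e_i$ whose data-generating distribution is $F^*$ on $\mathbb{R}$. Let $\alpha\in(0,1)$, $p\ge1$, and let $\boldsymbol{c}\in\mathbb{R}^d$ be fixed. Suppose that (i) the design matrix $\boldsymbol{X}\in\mathbb{R}^{N\times d}$ (with rows $\boldsymbol{x}_i^\top$) is of full rank, (ii) as $N\to\infty$, the matrix $\lim_{N\to\infty}\frac1N\boldsymbol{X}^\top\boldsymbol{X}$ exists and is finite and nonsingular, and $\Gamma_0:=\mathbb{E}^{F^*}[|e|^r]<\infty$ for some $r>2$. Then for any $\eta\in(0,1)$, $$\mathbb{P}\big(J_{\rm oos}\le\widehat J_N\big)\ge1-\eta,$$ where the radius is chosen as $$\varepsilon_N=\varepsilon_{1,N}+\frac{\alpha\vee(1-\alpha)}{\alpha\wedge(1-\alpha)}(\varepsilon_{2,N}+\varepsilon_{3,N}),$$ with $$\varepsilon_{1,N}=\frac{\alpha\vee(1-\alpha)}{\alpha\wedge(1-\alpha)}\left(360\sqrt{d+2}+2\sqrt{2\log\Big(\frac{3}{\eta'}\Big)}+\sqrt{\frac{3\Gamma_0}{\eta'}}\,\frac{32}{r-2}\sqrt{\log\Big(\frac{24}{\eta'}\Big)+2(d+2)}\right)\frac{\log(2N+1)^{1/r}}{\sqrt N},\quad\eta'=\frac{\eta}{3},$$ $$\varepsilon_{2,N}=\frac{3}{\eta}\,\Gamma_0^{1/r}\sqrt{\frac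 dN},\qquad \varepsilon_{3,N}=\Gamma_0^{1/r}\sqrt{\frac{3\,\boldsymbol{c}^\top(\boldsymbol{X}^\top\boldsymbol{X})^{-1}\boldsymbol{c}}{\eta}},$$ and $\varepsilon_{3,N}=O(1/\sqrt N)$ as $N\to\infty$.
   Context: The check loss is $\ell_\alpha(u)=u(\alpha-\mathbf{1}_{\{u<0\}})$. The ordinary least squares estimator is $\widehat{\boldsymbol\beta}_{\rm ols}=(\boldsymbol{X}^\top\boldsymbol{X})^{-1}\boldsymbol{X}^\top\mathbf{y}$ with $\mathbf{y}=(y_1,\dots,y_N)^\top$; the adjusted residuals are $z_i=y_i-\widehat{\boldsymbol\beta}_{\rm ols}^{\,\top}\boldsymbol{x}_i$, with empirical distribution $\widehat F_N^{\rm ols}=\frac1N\sum_{i=1}^N\delta_{z_i}$. For a fixed feature vector of interest $\boldsymbol{c}\in\mathbb{R}^d$, the target residual is $\overline e=e+(\boldsymbol\beta-\widehat{\boldsymbol\beta}_{\rm ols})^\top\boldsymbol{c}$, and $F^*_{\overline e}$ denotes its distribution when $e\sim F^*$ and the historical sample (hence $\widehat{\boldsymbol\beta}_{\rm ols}$) is treated as given. For a distribution $F_0$ on $\mathbb{R}$, $\mathbb{B}_p(F_0,\varepsilon)$ is the set of probability distributions $F$ on $\mathbb{R}$ with $W_p(F,F_0)\le\varepsilon$, where $W_p(F,G)=\inf_\Pi(\mathbb{E}^\Pi|\xi_1-\xi_2|^p)^{1/p}$ for $p<\infty$ and $W_\infty(F,G)=\inf_\Pi\operatorname{ess\,sup}^\Pi|\xi_1-\xi_2|$,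 over couplings $\Pi$ of $F$ and $G$. $\widehat s_N$ is an optimal solution of $\inf_{s\in\mathbb{R}}\sup_{F\in\mathbb{B}_p(\widehat F_N^{\rm ols},\varepsilon_N)}\mathbb{E}^F[\ell_\alpha(\overline e-s)]$ (under $\mathbb{E}^F$, $\overline e$ has distribution $F$). The in-sample and out-of-sample risks are $$\widehat J_N=\sup_{F\in\mathbb{B}_p(\widehat F_N^{\rm ols},\varepsilon_N)}\mathbb{E}^F[\ell_\alpha(\overline e-\widehat s_N)],\qquad J_{\rm oos}=\mathbb{E}^{F^*_{\overline e}}[\ell_\alpha(\overline e-\widehat s_N)].$$ $\mathbb{P}$ is the probability over the sample $e_1,\dots,e_N$. $a\vee b=\max\{a,b\}$, $a\wedge b=\min\{a,b\}$, and $\log(2N+1)^{1/r}$ means $(\log(2N+1))^{1/r}$.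
   Formalization: The error distribution F* is additionally assumed to have mean zero; without this the claim fails (d=1, x_i=1, c=0, α=1/2, F* a point mass at m≠0, N large). *)

theory Defs
  imports "HOL-Probability.Probability" "HOL-Probability.Essential_Supremum"
    "HOL-Library.Landau_Symbols"
begin

definition check_loss :: "real \<Rightarrow> real \<Rightarrow> real" where
  "check_loss \<alpha> u = u * (\<alpha> - indicator {v. v < 0} u)"

text \<open>Expectation of the check loss of \<open>\<xi> - s\<close> for \<open>\<xi>\<close> distributed as \<open>F\<close>.  For
  \<open>0 < \<alpha> < 1\<close> the loss is nonnegative, so the extended nonnegative integral is the
  expectation, also where it is infinite.\<close>

definition risk :: "real \<Rightarrow> real \<Rightarrow> real measure \<Rightarrow> ennreal" where
  "risk \<alpha> s F = (\<integral>\<^sup>+ \<xi>. ennreal (check_loss \<alpha> (\<xi> - s)) \<partial>F)"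

definition couplings :: "real measure \<Rightarrow> real measure \<Rightarrow> (real \<times> real) measure set" where
  "couplings F G = {P. sets P = sets (borel \<Otimes>\<^sub>M borel) \<and>
     distr P borel fst = F \<and> distr P borel snd = G}"

text \<open>Intended for exponents \<open>q > 0\<close>.\<close>

definition ennreal_powr :: "ennreal \<Rightarrow> real \<Rightarrow> ennreal" where
  "ennreal_powr a q = (if a = \<top> then \<top> else ennreal (enn2real a powr q))"

definition wasserstein :: "ennreal \<Rightarrow> real measure \<Rightarrow> real measure \<Rightarrow> ennreal" where
  "wasserstein p F G =
     (if p = \<top>
      then (INF P\<in>couplings F G. esssup P (\<lambda>(\<xi>\<^sub>1, \<xi>\<^sub>2). ennreal \<bar>\<xi>\<^sub>1 - \<xi>\<^sub>2\<bar>))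
      else (INF P\<in>couplings F G.
        ennreal_powr (\<integral>\<^sup>+ (\<xi>\<^sub>1, \<xi>\<^sub>2). ennreal (\<bar>\<xi>\<^sub>1 - \<xi>\<^sub>2\<bar> powr enn2real p) \<partial>P)
          (1 / enn2real p)))"

definition wball :: "ennreal \<Rightarrow> real measure \<Rightarrow> real \<Rightarrow> real measure set" where
  "wball p F\<^sub>0 \<epsilon> = {F. prob_space F \<and> sets F = sets borel \<and> wasserstein p F F\<^sub>0 \<le> ennreal \<epsilon>}"

definition worst_case_risk :: "real \<Rightarrow> ennreal \<Rightarrow> real measure \<Rightarrow> real \<Rightarrow> real \<Rightarrow> ennreal" where
  "worst_case_risk \<alpha> p F\<^sub>0 \<epsilon> s = (SUP F\<in>wball p F\<^sub>0 \<epsilon>. risk \<alpha> s F)"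

text \<open>The design matrix \<open>X\<close> for sample size \<open>N\<close> has the rows \<open>x 1, \<dots>, x N\<close>.  As \<open>N\<close> varies it is
  not given a matrix type of its own; only \<open>X\<^sup>T X\<close> (\<open>gram\<close>), \<open>X\<^sup>T y\<close> (the sum in \<open>ols\<close>) and
  the rank of \<open>X\<close> occur, the latter being \<open>dim (x ` {1..N})\<close>, which is how the library defines
  the rank of a real matrix (lemma \<open>row_rank_def\<close>).\<close>

definition gram :: "(nat \<Rightarrow> real ^ 'd) \<Rightarrow> nat \<Rightarrow> real ^ 'd ^ 'd" where
  "gram x N = (\<chi> j k. \<Sum>i=1..N. x i $ j * x i $ k)"

definition ols :: "(nat \<Rightarrow> real ^ 'd) \<Rightarrow> (nat \<Rightarrow> real) \<Rightarrow> nat \<Rightarrow> real ^ 'd" where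
  "ols x y N = matrix_inv (gram x N) *v (\<Sum>i=1..N. y i *\<^sub>R x i)"

definition residual :: "(nat \<Rightarrow> real ^ 'd) \<Rightarrow> (nat \<Rightarrow> real) \<Rightarrow> nat \<Rightarrow> nat \<Rightarrow> real" where
  "residual x y N i = y i - ols x y N \<bullet> x i"

definition empirical :: "nat \<Rightarrow> (nat \<Rightarrow> real) \<Rightarrow> real measure" where
  "empirical N z = distr (measure_pmf (pmf_of_set {1..N})) borel z"

text \<open>Distribution of the target residual \<open>e + (\<beta> - b) \<bullet> c\<close> when \<open>e\<close> has distribution \<open>F\<close> and the
  estimate \<open>b\<close> is held fixed.\<close>

definition target_dist ::
    "real measure \<Rightarrow> real ^ 'd \<Rightarrow> real ^ 'd \<Rightarrow> real ^ 'd \<Rightarrow> real measure" where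
  "target_dist F \<beta> b c = distr F borel (\<lambda>e. e + (\<beta> - b) \<bullet> c)"

definition loss_ratio :: "real \<Rightarrow> real" where
  "loss_ratio \<alpha> = max \<alpha> (1 - \<alpha>) / min \<alpha> (1 - \<alpha>)"

definition eps1 :: "nat \<Rightarrow> real \<Rightarrow> real \<Rightarrow> real \<Rightarrow> real \<Rightarrow> nat \<Rightarrow> real" where
  "eps1 d \<alpha> r \<Gamma>\<^sub>0 \<eta> N = (let \<eta>' = \<eta> / 3 in
     loss_ratio \<alpha> *
     (360 * sqrt (real d + 2) + 2 * sqrt (2 * ln (3 / \<eta>')) +
      sqrt (3 * \<Gamma>\<^sub>0 / \<eta>') * (32 / (r - 2)) * sqrt (ln (24 / \<eta>') + 2 * (real d + 2))) *
     (ln (2 * real N + 1) powr (1 / r) / sqrt (real N)))"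

definition eps2 :: "nat \<Rightarrow> real \<Rightarrow> real \<Rightarrow> real \<Rightarrow> nat \<Rightarrow> real" where
  "eps2 d r \<Gamma>\<^sub>0 \<eta> N = 3 / \<eta> * \<Gamma>\<^sub>0 powr (1 / r) * sqrt (real d / real N)"

definition eps3 ::
    "(nat \<Rightarrow> real ^ 'd) \<Rightarrow> real ^ 'd \<Rightarrow> real \<Rightarrow> real \<Rightarrow> real \<Rightarrow> nat \<Rightarrow> real" where
  "eps3 x c r \<Gamma>\<^sub>0 \<eta> N =
     \<Gamma>\<^sub>0 powr (1 / r) * sqrt (3 * (c \<bullet> (matrix_inv (gram x N) *v c)) / \<eta>)"

definition eps ::
    "(nat \<Rightarrow> real ^ 'd) \<Rightarrow> real ^ 'd \<Rightarrow> real \<Rightarrow> real \<Rightarrow> real \<Rightarrow> real \<Rightarrow> nat \<Rightarrow> real" where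
  "eps x c \<alpha> r \<Gamma>\<^sub>0 \<eta> N = eps1 CARD('d) \<alpha> r \<Gamma>\<^sub>0 \<eta> N +
     loss_ratio \<alpha> * (eps2 CARD('d) r \<Gamma>\<^sub>0 \<eta> N + eps3 x c r \<Gamma>\<^sub>0 \<eta> N)"

end

theory Submission
  imports Defs
begin

text \<open>
  Write \<open>L = max \<alpha> (1 - \<alpha>)\<close> and \<open>m = min \<alpha> (1 - \<alpha>)\<close>.  The check loss is \<open>L\<close>-Lipschitz, and moving
  its argument away from \<open>0\<close> by \<open>\<epsilon>\<close> raises it by at least \<open>m * \<epsilon>\<close>.  Pushing every atom of the
  empirical distribution outward by \<open>\<epsilon>\<close> stays in the Wasserstein ball for every order \<open>p\<close>, so the
  in-sample risk exceeds the empirical risk of the adjusted residuals by at least \<open>m * \<epsilon>\<close>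
  (\<open>worst_case_risk_ge_risk_empirical\<close>).  It remains to bound, uniformly in \<open>s\<close>, the
  out-of-sample risk minus the empirical risk by \<open>m * \<epsilon>\<close>; the factor \<open>L / m\<close> in the radius turns
  this into a bound by \<open>L\<close> times the sum of three errors.

  The first two errors come from the regression.  Both \<open>(\<beta> - b) \<bullet> c\<close> and the shifts
  \<open>(\<beta> - b) \<bullet> x i\<close> between errors and adjusted residuals are linear combinations of the errors, with
  second moments given by the inverse Gram matrix (\<open>ols_error\<close>, \<open>ols_weights_norm\<close>,
  \<open>ols_leverage_sum\<close>), and Chebyshev's inequality gives \<open>eps3\<close> and \<open>eps2\<close>.

  The third error compares the law \<open>F\<close> of the errors with its empirical version \<open>F_N\<close>.  The risk is
  an integral of distribution-function values, so uniformly in \<open>s\<close> this error is at most the \<open>L1\<close>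
  distance of the two distribution functions (\<open>risk_le_risk_plus_cdf_distance\<close>).  This distance is
  split at \<open>\<bar>t\<bar> = 1\<close>.  On \<open>[-1, 1]\<close>, Hoeffding's lemma bounds the exponential moments of
  \<open>F_N t - F t\<close> for each \<open>t\<close>, and these bounds may be integrated over \<open>t\<close>
  (\<open>cdf_error_core_le\<close>); this yields a bound of order \<open>sqrt (ln (1 / \<delta>) / N)\<close>.  Outside, the variance of \<open>F_N t\<close> is at
  most \<open>\<Gamma>\<^sub>0 * \<bar>t\<bar> powr (- r) / N\<close>, and since \<open>r > 2\<close> its square root is integrable at infinity
  (\<open>cdf_error_tail_le\<close>); this yields one of order \<open>sqrt (\<Gamma>\<^sub>0 / \<delta>) / ((r - 2) * sqrt N)\<close>.  Both fit into \<open>eps1\<close>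
  with room to spare.

  The measure of a set is only meaningful if the set is measurable.  That is settled by showing that
  the worst-case risk is Lipschitz in the atoms of the centre and in \<open>s\<close>
  (\<open>worst_case_risk_lipschitz\<close>): a near-optimal coupling can be carried along when the atoms move.
\<close>

section \<open>Check loss, transport plans and the worst-case risk\<close>

lemma check_loss_eq_max:
  assumes "0 < \<alpha>" "\<alpha> < 1"
  shows "check_loss \<alpha> u = max (\<alpha> * u) ((\<alpha> - 1) * u)"
proof (cases "u < 0")
  case True
  hence "\<alpha> * u \<le> 0" "(\<alpha> - 1) * u \<ge> 0"
    using assms by (auto simp: mult_le_0_iff zero_le_mult_iff)
  thus ?thesis using True by (simp add: check_loss_def max_def algebra_simps)
next
  case False
  hence "\<alpha> * u \<ge> 0" "(\<alpha> - 1) * u \<le> 0"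
    using assms by (auto simp: mult_le_0_iff zero_le_mult_iff)
  thus ?thesis using False by (simp add: check_loss_def max_def algebra_simps)
qed

lemma check_loss_nonneg: "0 < \<alpha> \<Longrightarrow> \<alpha> < 1 \<Longrightarrow> 0 \<le> check_loss \<alpha> u"
  by (auto simp: check_loss_def indicator_def mult_le_0_iff zero_le_mult_iff)

lemma check_loss_measurable [measurable]: "check_loss \<alpha> \<in> borel_measurable borel"
  unfolding check_loss_def[abs_def] by measurable

lemma check_loss_lipschitz:
  assumes "0 < \<alpha>" "\<alpha> < 1"
  shows "check_loss \<alpha> u \<le> check_loss \<alpha> v + max \<alpha> (1 - \<alpha>) * \<bar>u - v\<bar>"
proof -
  have "\<alpha> * (u - v) \<le> max \<alpha> (1 - \<alpha>) * \<bar>u - v\<bar>"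
    by (rule order_trans[OF mult_left_mono mult_right_mono]) (use assms in auto)
  moreover have "(\<alpha> - 1) * (u - v) \<le> max \<alpha> (1 - \<alpha>) * \<bar>u - v\<bar>"
  proof -
    have "(\<alpha> - 1) * (u - v) = (1 - \<alpha>) * (v - u)" by algebra
    also have "\<dots> \<le> max \<alpha> (1 - \<alpha>) * \<bar>u - v\<bar>" 
      by (rule order_trans[OF mult_left_mono mult_right_mono]) (use assms in auto)
    finally show ?thesis .
  qed
  ultimately show ?thesis
    unfolding check_loss_eq_max[OF assms] by (auto simp: algebra_simps max_def)
qed

text \<open>The slope of the loss is \<open>\<alpha>\<close> to the right of \<open>0\<close> and \<open>\<alpha> - 1\<close> to the left, so a step outward
  gains at least the smaller of the two rates.\<close>

lemma check_loss_outward: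
  assumes "0 < \<alpha>" "\<alpha> < 1" "0 \<le> \<epsilon>"
  shows "check_loss \<alpha> u + \<epsilon> * min \<alpha> (1 - \<alpha>) \<le> check_loss \<alpha> (u + (if 0 \<le> u then \<epsilon> else - \<epsilon>))"
proof -
  have "\<epsilon> * min \<alpha> (1 - \<alpha>) \<le> \<epsilon> * \<alpha>" "\<epsilon> * min \<alpha> (1 - \<alpha>) \<le> \<epsilon> * (1 - \<alpha>)"
    using assms by (auto intro!: mult_left_mono)
  thus ?thesis using assms by (auto simp: check_loss_def algebra_simps)
qed

lemma risk_distr:
  assumes [measurable]: "f \<in> borel_measurable K"
  shows "risk \<alpha> s (distr K borel f) = (\<integral>\<^sup>+ w. ennreal (check_loss \<alpha> (f w - s)) \<partial>K)"
  unfolding risk_def by (subst nn_integral_distr) auto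

lemma risk_empirical:
  assumes "N \<ge> 1"
  shows "risk \<alpha> s (empirical N z) = (\<Sum>i=1..N. ennreal (check_loss \<alpha> (z i - s))) / of_nat N"
  using assms unfolding empirical_def
  by (subst risk_distr) (auto simp: nn_integral_pmf_of_set simp flip: ennreal_of_nat_eq_real_of_nat)

lemma prob_space_empirical: "prob_space (empirical N z)"
  unfolding empirical_def by (rule measure_pmf.prob_space_distr) auto

lemma sets_empirical [simp, measurable_cong]: "sets (empirical N z) = sets borel"
  by (simp add: empirical_def)

text \<open>The transport cost of \<open>P\<close> is at most \<open>c\<close>.  Taking \<open>p\<close>-th powers on both sides avoids roots in
  the extended reals and treats all orders, including \<open>\<infinity>\<close>, by one predicate.\<close>

definition displacement_le :: "ennreal \<Rightarrow> (real \<times> real) measure \<Rightarrow> real \<Rightarrow> bool" where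
  "displacement_le p P c \<longleftrightarrow>
     (if p = \<top> then AE w in P. \<bar>fst w - snd w\<bar> \<le> c
      else (\<integral>\<^sup>+ w. ennreal (\<bar>fst w - snd w\<bar> powr enn2real p) \<partial>P) \<le> ennreal (c powr enn2real p))"

lemma enn2real_ge_1: "1 \<le> p \<Longrightarrow> p \<noteq> \<top> \<Longrightarrow> 1 \<le> enn2real p"
  by (metis enn2real_1 enn2real_mono top.not_eq_extremum)

lemma wasserstein_leI:
  assumes P: "P \<in> couplings F G" and d: "displacement_le p P c" and c: "0 \<le> c" and p: "1 \<le> p"
  shows "wasserstein p F G \<le> ennreal c"
proof -
  have [measurable_cong]: "sets P = sets (borel \<Otimes>\<^sub>M borel)"
    using P by (simp add: couplings_def)
  show ?thesis
  proof (cases "p = \<top>")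
    case True
    have "AE w in P. (case w of (a, b) \<Rightarrow> ennreal \<bar>a - b\<bar>) \<le> ennreal c"
      using d True by (auto simp: displacement_le_def case_prod_beta' intro!: ennreal_leI)
    hence "esssup P (\<lambda>(\<xi>\<^sub>1, \<xi>\<^sub>2). ennreal \<bar>\<xi>\<^sub>1 - \<xi>\<^sub>2\<bar>) \<le> ennreal c"
      by (intro esssup_I) measurable
    thus ?thesis unfolding wasserstein_def using True P by (auto intro: INF_lower2)
  next
    case False
    define q where "q = enn2real p"
    have q: "q \<ge> 1" using enn2real_ge_1 p False by (simp add: q_def)
    let ?I = "\<integral>\<^sup>+ (\<xi>\<^sub>1, \<xi>\<^sub>2). ennreal (\<bar>\<xi>\<^sub>1 - \<xi>\<^sub>2\<bar> powr q) \<partial>P"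
    have I: "?I \<le> ennreal (c powr q)"
      using d False by (simp add: displacement_le_def q_def case_prod_beta')
    then obtain x where x: "?I = ennreal x" "0 \<le> x" "x \<le> c powr q"
      by (cases ?I) (auto simp: top_unique)
    have "ennreal_powr ?I (1 / q) = ennreal (x powr (1 / q))"
      using x by (simp add: ennreal_powr_def)
    also have "x powr (1 / q) \<le> (c powr q) powr (1 / q)"
      using x q by (intro powr_mono2) auto
    also have "(c powr q) powr (1 / q) = c" using q c by (simp add: powr_powr)
    finally have "ennreal_powr ?I (1 / q) \<le> ennreal c" by (simp add: ennreal_leI)
    thus ?thesis unfolding wasserstein_def using False P by (auto intro: INF_lower2 simp: q_def)
  qed
qed

text \<open>The definition takes an infimum over couplings, so a coupling is only available at a cost
  strictly above the distance; this is why couplings are shrunk below.\<close>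

lemma wasserstein_lessD:
  assumes w: "wasserstein p F G < ennreal c" and p: "1 \<le> p"
  obtains P where "P \<in> couplings F G" "displacement_le p P c"
proof (cases "p = \<top>")
  case True
  from w obtain P where P: "P \<in> couplings F G"
      "esssup P (\<lambda>(\<xi>\<^sub>1, \<xi>\<^sub>2). ennreal \<bar>\<xi>\<^sub>1 - \<xi>\<^sub>2\<bar>) < ennreal c"
    unfolding wasserstein_def using True by (auto simp: INF_less_iff)
  have c: "c > 0" using w by (metis ennreal_neg not_less_zero linorder_not_le)
  have "AE w in P. (case w of (a, b) \<Rightarrow> ennreal \<bar>a - b\<bar>) \<le> esssup P (\<lambda>(\<xi>\<^sub>1, \<xi>\<^sub>2). ennreal \<bar>\<xi>\<^sub>1 - \<xi>\<^sub>2\<bar>)"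
    by (rule esssup_AE)
  hence "AE w in P. \<bar>fst w - snd w\<bar> \<le> c"
  proof eventually_elim
    case (elim w)
    hence "ennreal \<bar>fst w - snd w\<bar> < ennreal c" using P(2) by (auto simp: case_prod_beta')
    thus ?case using c by (simp add: ennreal_less_iff)
  qed
  thus ?thesis using that P(1) True by (simp add: displacement_le_def)
next
  case False
  define q where "q = enn2real p"
  have q: "q \<ge> 1" using enn2real_ge_1 p False by (simp add: q_def)
  from w obtain P where P: "P \<in> couplings F G"
      "ennreal_powr (\<integral>\<^sup>+ (\<xi>\<^sub>1, \<xi>\<^sub>2). ennreal (\<bar>\<xi>\<^sub>1 - \<xi>\<^sub>2\<bar> powr q) \<partial>P) (1 / q) < ennreal c"
    unfolding wasserstein_def using False by (auto simp: INF_less_iff q_def)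
  have c: "c > 0" using w by (metis ennreal_neg not_less_zero linorder_not_le)
  let ?I = "\<integral>\<^sup>+ (\<xi>\<^sub>1, \<xi>\<^sub>2). ennreal (\<bar>\<xi>\<^sub>1 - \<xi>\<^sub>2\<bar> powr q) \<partial>P"
  have "?I \<noteq> \<top>" using P(2) by (auto simp: ennreal_powr_def)
  then obtain x where x: "?I = ennreal x" "0 \<le> x"
    by (cases ?I) auto
  have "x powr (1 / q) \<le> c"
    using P(2) x c by (simp add: ennreal_powr_def ennreal_less_iff)
  hence "(x powr (1 / q)) powr q \<le> c powr q" using q by (intro powr_mono2) auto
  hence "x \<le> c powr q" using q x by (simp add: powr_powr)
  hence "displacement_le p P c"
    using x False by (simp add: displacement_le_def q_def case_prod_beta' ennreal_leI)
  thus ?thesis using that P(1) by blast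
qed

text \<open>The distribution \<open>empirical N z'\<close> with every atom pushed by \<open>\<epsilon>\<close> away from \<open>s\<close> lies in the ball:
  all displacements equal \<open>\<epsilon>\<close>, so the transport cost is \<open>\<epsilon>\<close> whatever the order \<open>p\<close>.\<close>

lemma worst_case_risk_ge_risk_empirical:
  assumes \<alpha>: "0 < \<alpha>" "\<alpha> < 1" and p: "1 \<le> p" and \<epsilon>: "0 \<le> \<epsilon>" and N: "N \<ge> 1"
  shows "risk \<alpha> s (empirical N z) + ennreal (\<epsilon> * min \<alpha> (1 - \<alpha>))
           \<le> worst_case_risk \<alpha> p (empirical N z) \<epsilon> s"
proof -
  define z' where "z' = (\<lambda>i. z i + (if 0 \<le> z i - s then \<epsilon> else - \<epsilon>))"
  define U where "U = measure_pmf (pmf_of_set {1..N})"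
  define P where "P = distr U (borel \<Otimes>\<^sub>M borel) (\<lambda>i. (z' i, z i))"
  have [measurable]: "f \<in> measurable U borel" for f :: "nat \<Rightarrow> real"
    by (simp add: U_def)
  have PU: "prob_space U" by (simp add: U_def measure_pmf.prob_space_axioms)
  have "P \<in> couplings (empirical N z') (empirical N z)"
    unfolding couplings_def P_def empirical_def U_def[symmetric] by (auto simp: distr_distr o_def)
  moreover have "displacement_le p P \<epsilon>"
  proof (cases "p = \<top>")
    case True
    thus ?thesis unfolding displacement_le_def P_def using \<epsilon>
      by (auto simp: AE_distr_iff z'_def)
  next
    case False
    have "enn2real p \<ge> 1" using enn2real_ge_1 p False by simp
    hence "(\<integral>\<^sup>+ w. ennreal (\<bar>fst w - snd w\<bar> powr enn2real p) \<partial>P)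
           = (\<integral>\<^sup>+ i. ennreal (\<bar>z' i - z i\<bar> powr enn2real p) \<partial>U)"
      unfolding P_def by (subst nn_integral_distr) auto
    also have "\<dots> = (\<integral>\<^sup>+ i. ennreal (\<epsilon> powr enn2real p) \<partial>U)"
      using \<epsilon> by (intro nn_integral_cong) (auto simp: z'_def)
    also have "\<dots> = ennreal (\<epsilon> powr enn2real p)"
      using prob_space.emeasure_space_1[OF PU] by simp
    finally show ?thesis using False by (simp add: displacement_le_def)
  qed
  ultimately have "wasserstein p (empirical N z') (empirical N z) \<le> ennreal \<epsilon>"
    using \<epsilon> p by (rule wasserstein_leI)
  hence "empirical N z' \<in> wball p (empirical N z) \<epsilon>"
    by (simp add: wball_def prob_space_empirical)
  hence le: "risk \<alpha> s (empirical N z') \<le> worst_case_risk \<alpha> p (empirical N z) \<epsilon> s"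
    unfolding worst_case_risk_def by (rule SUP_upper)
  have "risk \<alpha> s (empirical N z) + ennreal (\<epsilon> * min \<alpha> (1 - \<alpha>))
        = (\<integral>\<^sup>+ i. ennreal (check_loss \<alpha> (z i - s)) \<partial>U) + (\<integral>\<^sup>+ i. ennreal (\<epsilon> * min \<alpha> (1 - \<alpha>)) \<partial>U)"
    unfolding empirical_def U_def[symmetric]
    using prob_space.emeasure_space_1[OF PU] by (subst risk_distr) auto
  also have "\<dots> = (\<integral>\<^sup>+ i. ennreal (check_loss \<alpha> (z i - s) + \<epsilon> * min \<alpha> (1 - \<alpha>)) \<partial>U)"
    using \<alpha> \<epsilon> by (subst nn_integral_add[symmetric])
      (auto intro!: nn_integral_cong simp: ennreal_plus check_loss_nonneg)
  also have "\<dots> \<le> (\<integral>\<^sup>+ i. ennreal (check_loss \<alpha> (z' i - s)) \<partial>U)"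
  proof (intro nn_integral_mono ennreal_leI)
    fix i
    show "check_loss \<alpha> (z i - s) + \<epsilon> * min \<alpha> (1 - \<alpha>) \<le> check_loss \<alpha> (z' i - s)"
      using check_loss_outward[OF \<alpha> \<epsilon>, of "z i - s"] by (simp add: z'_def algebra_simps)
  qed
  also have "\<dots> = risk \<alpha> s (empirical N z')"
    unfolding empirical_def U_def[symmetric] by (subst risk_distr) auto
  finally show ?thesis using le by (rule order_trans)
qed

text \<open>A coupling with an empirical distribution only sees the values \<open>z i\<close>, not the indices, and several
  indices may share a value.  Drawing the index uniformly among those with the observed value lifts
  the coupling to indices; afterwards the atoms can be moved independently of each other.\<close>

lemma coupling_with_empirical_lift:
  fixes z :: "nat \<Rightarrow> real"
  assumes P: "P \<in> couplings F (empirical N z)" and N: "N \<ge> 1"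
  obtains K :: "((real \<times> real) \<times> nat) measure" where
    "sets K = sets ((borel \<Otimes>\<^sub>M borel) \<Otimes>\<^sub>M count_space UNIV)"
    "distr K (borel \<Otimes>\<^sub>M borel) fst = P"
    "distr K (count_space UNIV) snd = measure_pmf (pmf_of_set {1..N})"
    "AE w in K. snd (fst w) = z (snd w)"
proof -
  have setsP [measurable_cong]: "sets P = sets (borel \<Otimes>\<^sub>M borel)"
    and Psnd: "distr P borel snd = empirical N z"
    using P by (auto simp: couplings_def)
  \<comment> \<open>The number of indices with a given value, by which the mass of that value is divided.\<close>
  define n :: "real \<Rightarrow> ennreal" where "n = (\<lambda>v. \<Sum>i\<in>{1..N}. if z i = v then 1 else 0)"
  have [measurable]: "n \<in> borel_measurable borel" unfolding n_def by measurable
  define g :: "(real \<times> real) \<times> nat \<Rightarrow> ennreal"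
    where "g = (\<lambda>w. if snd w \<in> {1..N} \<and> z (snd w) = snd (fst w) then 1 / n (snd (fst w)) else 0)"
  let ?C = "count_space (UNIV :: nat set)"
  have m1: "(\<lambda>w. z (snd w)) \<in> borel_measurable (P \<Otimes>\<^sub>M ?C)"
    by (rule measurable_compose[OF measurable_snd]) simp
  have m2: "(\<lambda>w. snd (fst w)) \<in> borel_measurable (P \<Otimes>\<^sub>M ?C)"
    by (rule measurable_compose[OF measurable_fst]) measurable
  have m3: "Measurable.pred (P \<Otimes>\<^sub>M ?C) (\<lambda>w. z (snd w) = snd (fst w))"
    unfolding pred_def by (rule borel_measurable_eq) (fact m1 m2)+
  have gm [measurable]: "g \<in> borel_measurable (P \<Otimes>\<^sub>M ?C)"
    unfolding g_def
  proof (rule measurable_If)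
    show "(\<lambda>w. 1 / n (snd (fst w))) \<in> borel_measurable (P \<Otimes>\<^sub>M ?C)"
      by (rule measurable_compose[OF m2]) measurable
    have "Measurable.pred (P \<Otimes>\<^sub>M ?C) (\<lambda>w. snd w \<in> {1..N} \<and> z (snd w) = snd (fst w))"
      by (intro pred_intros_logic m3 measurable_compose[OF measurable_snd, of "\<lambda>i. i \<in> {1..N}"]) simp
    thus "{w \<in> space (P \<Otimes>\<^sub>M ?C). snd w \<in> {1..N} \<and> z (snd w) = snd (fst w)} \<in> sets (P \<Otimes>\<^sub>M ?C)"
      by (simp only: pred_def)
  qed simp
  interpret C: sigma_finite_measure ?C
    by (rule sigma_finite_measure_count_space)
  define K where "K = density (P \<Otimes>\<^sub>M ?C) g"
  have setsK [measurable_cong]: "sets K = sets ((borel \<Otimes>\<^sub>M borel) \<Otimes>\<^sub>M ?C)"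
    unfolding K_def sets_density by (rule sets_pair_measure_cong[OF setsP refl])
  have n_ge: "n (z i) \<noteq> 0" "n v \<noteq> \<top>" if "i \<in> {1..N}" for i v
    using that by (auto simp: n_def sum_nonneg_eq_0_iff)
  have int_K: "(\<integral>\<^sup>+ w. f w \<partial>K) = (\<integral>\<^sup>+ v. (\<Sum>i\<in>{1..N}. g (v, i) * f (v, i)) \<partial>P)"
    if [measurable]: "f \<in> borel_measurable (P \<Otimes>\<^sub>M ?C)" for f
  proof -
    have "(\<integral>\<^sup>+ w. f w \<partial>K) = (\<integral>\<^sup>+ v. (\<integral>\<^sup>+ i. g (v, i) * f (v, i) \<partial>?C) \<partial>P)"
      unfolding K_def by (subst nn_integral_density) (auto simp: C.nn_integral_fst[symmetric])
    also have "\<dots> = (\<integral>\<^sup>+ v. (\<Sum>i\<in>{1..N}. g (v, i) * f (v, i)) \<partial>P)"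
      by (intro nn_integral_cong nn_integral_count_space') (auto simp: g_def)
    finally show ?thesis .
  qed
  have emp: "(\<integral>\<^sup>+ v. h (snd v) \<partial>P) = (\<Sum>i\<in>{1..N}. h (z i)) / of_nat N"
    if [measurable]: "h \<in> borel_measurable borel" for h
  proof -
    have "(\<integral>\<^sup>+ v. h (snd v) \<partial>P) = (\<integral>\<^sup>+ b. h b \<partial>distr P borel snd)"
      by (subst nn_integral_distr) auto
    also have "\<dots> = (\<Sum>i\<in>{1..N}. h (z i)) / of_nat N"
      unfolding Psnd empirical_def using N
      by (subst nn_integral_distr) (auto simp: nn_integral_pmf_of_set simp flip: ennreal_of_nat_eq_real_of_nat)
    finally show ?thesis .
  qed
  have "distr K (borel \<Otimes>\<^sub>M borel) fst = P"
  proof (rule measure_eqI)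
    fix A assume "A \<in> sets (distr K (borel \<Otimes>\<^sub>M borel) fst)"
    hence A [measurable]: "A \<in> sets P" by (simp add: setsP)
    have "AE v in P. snd v \<in> z ` {1..N}"
    proof -
      have [measurable]: "- z ` {1..N} \<in> sets borel"
        by (intro borel_open open_Compl finite_imp_closed) auto
      have ind: "(indicator (- z ` {1..N}) :: real \<Rightarrow> ennreal) \<in> borel_measurable borel"
        by measurable
      have "(\<integral>\<^sup>+ v. indicator (- z ` {1..N}) (snd v) \<partial>P) = 0"
        by (subst emp[OF ind]) auto
      moreover have "(\<lambda>v. indicator (- z ` {1..N}) (snd v) :: ennreal) \<in> borel_measurable P"
        by (rule measurable_compose[OF _ ind]) measurable
      ultimately have "AE v in P. indicator (- z ` {1..N}) (snd v) = (0 :: ennreal)"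
        by (simp only: nn_integral_0_iff_AE)
      thus ?thesis by eventually_elim (auto simp: indicator_def split: if_splits)
    qed
    hence AE1: "AE v in P. (\<Sum>i\<in>{1..N}. g (v, i)) = 1"
    proof eventually_elim
      case (elim v)
      then obtain j where j: "j \<in> {1..N}" "snd v = z j" by auto
      have "(\<Sum>i\<in>{1..N}. g (v, i)) = (\<Sum>i\<in>{1..N}. (if z i = z j then 1 else 0) * (1 / n (z j)))"
        by (intro sum.cong) (auto simp: g_def j)
      also have "\<dots> = n (z j) * (1 / n (z j))" unfolding n_def by (rule sum_distrib_right[symmetric])
      also have "\<dots> = 1" using n_ge[OF j(1)]
        by (simp add: ennreal_times_divide ennreal_divide_self top.not_eq_extremum)
      finally show ?case .
    qed
    have A' [measurable]: "A \<in> sets (borel \<Otimes>\<^sub>M borel)" using A by (simp only: setsP)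
    have "emeasure (distr K (borel \<Otimes>\<^sub>M borel) fst) A
          = (\<integral>\<^sup>+ v. indicator A v \<partial>distr K (borel \<Otimes>\<^sub>M borel) fst)"
      by (rule nn_integral_indicator[symmetric]) (simp only: sets_distr A')
    also have "\<dots> = (\<integral>\<^sup>+ w. indicator A (fst w) \<partial>K)"
      by (rule nn_integral_distr) measurable
    also have "\<dots> = (\<integral>\<^sup>+ v. (\<Sum>i\<in>{1..N}. g (v, i)) * indicator A v \<partial>P)"
      by (subst int_K) (auto simp: sum_distrib_right)
    also have "\<dots> = (\<integral>\<^sup>+ v. indicator A v \<partial>P)"
      using AE1 by (intro nn_integral_cong_AE) auto
    finally show "emeasure (distr K (borel \<Otimes>\<^sub>M borel) fst) A = emeasure P A" by simp
  qed (simp add: setsP)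
  moreover have "distr K ?C snd = measure_pmf (pmf_of_set {1..N})"
  proof (rule measure_eqI)
    fix A assume "A \<in> sets (distr K ?C snd)"
    have mass: "(\<integral>\<^sup>+ v. g (v, i) \<partial>P) = 1 / of_nat N" if i: "i \<in> {1..N}" for i
    proof -
      have "(\<integral>\<^sup>+ v. g (v, i) \<partial>P) = (\<integral>\<^sup>+ v. (if z i = snd v then 1 / n (snd v) else 0) \<partial>P)"
        using i by (intro nn_integral_cong) (simp add: g_def)
      also have "\<dots> = (\<Sum>j\<in>{1..N}. if z i = z j then 1 / n (z j) else 0) / of_nat N"
        by (rule emp) measurable
      also have "(\<Sum>j\<in>{1..N}. if z i = z j then 1 / n (z j) else 0)
                 = (\<Sum>j\<in>{1..N}. (if z j = z i then 1 else 0) * (1 / n (z i)))"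
        by (intro sum.cong) auto
      also have "\<dots> = n (z i) * (1 / n (z i))" unfolding n_def by (rule sum_distrib_right[symmetric])
      also have "\<dots> = 1" using n_ge[OF i]
        by (simp add: ennreal_times_divide ennreal_divide_self top.not_eq_extremum)
      finally show ?thesis .
    qed
    have "emeasure (distr K ?C snd) A = (\<integral>\<^sup>+ i. indicator A i \<partial>distr K ?C snd)"
      by (rule nn_integral_indicator[symmetric]) simp
    also have "\<dots> = (\<integral>\<^sup>+ w. indicator A (snd w) \<partial>K)"
      by (rule nn_integral_distr) auto
    also have "\<dots> = (\<integral>\<^sup>+ v. (\<Sum>i\<in>{1..N}. g (v, i) * indicator A i) \<partial>P)"
      by (subst int_K) auto
    also have "\<dots> = (\<Sum>i\<in>{1..N}. (\<integral>\<^sup>+ v. g (v, i) \<partial>P) * indicator A i)"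
      by (simp add: nn_integral_sum nn_integral_multc)
    also have "\<dots> = (\<Sum>i\<in>{1..N}. 1 / of_nat N * indicator A i)"
      by (intro sum.cong refl) (simp only: mass)
    also have "\<dots> = (\<Sum>i\<in>{1..N}. indicator A i) / of_nat N"
      by (simp only: divide_ennreal_def mult_1_left sum_distrib_left[symmetric] mult.commute)
    also have "\<dots> = (\<integral>\<^sup>+ i. indicator A i \<partial>measure_pmf (pmf_of_set {1..N}))"
      using N by (simp add: nn_integral_pmf_of_set ennreal_of_nat_eq_real_of_nat del: nn_integral_indicator)
    finally show "emeasure (distr K ?C snd) A = emeasure (measure_pmf (pmf_of_set {1..N})) A"
      by simp
  qed simp
  moreover have "AE w in K. snd (fst w) = z (snd w)"
    unfolding K_def by (subst AE_density[OF gm]) (auto simp: g_def)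
  ultimately show ?thesis using that[of K] setsK by blast
qed

section \<open>Continuity and measurability of the worst-case risk\<close>

text \<open>All that matters here is that the mean displacement is finite, with a bound depending only on
  \<open>c\<close>; the crude estimate \<open>t \<le> 1 + t powr q\<close> is enough.\<close>

lemma mean_displacement_le:
  assumes "prob_space P" and [measurable_cong]: "sets P = sets (borel \<Otimes>\<^sub>M borel)"
    and d: "displacement_le p P c" and p: "1 \<le> p" and c: "0 \<le> c"
  shows "(\<integral>\<^sup>+ w. ennreal \<bar>fst w - snd w\<bar> \<partial>P) \<le> ennreal (1 + c + c powr enn2real p)"
proof (cases "p = \<top>")
  case True
  interpret prob_space P by fact
  have "(\<integral>\<^sup>+ w. ennreal \<bar>fst w - snd w\<bar> \<partial>P) \<le> (\<integral>\<^sup>+ w. ennreal c \<partial>P)"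
    using d True by (intro nn_integral_mono_AE) (auto simp: displacement_le_def intro: ennreal_leI)
  also have "\<dots> = ennreal c" by (simp add: emeasure_space_1)
  also have "\<dots> \<le> ennreal (1 + c + c powr enn2real p)" by (intro ennreal_leI) (simp add: c)
  finally show ?thesis .
next
  case False
  interpret prob_space P by fact
  define q where "q = enn2real p"
  have q: "q \<ge> 1" using enn2real_ge_1 p False by (simp add: q_def)
  have pw: "t \<le> 1 + t powr q" if "0 \<le> t" for t :: real
  proof (cases "t \<le> 1")
    case False
    hence "t powr 1 \<le> t powr q" using q by (intro powr_mono) auto
    thus ?thesis using False by simp
  qed (simp add: add_increasing2)
  have "(\<integral>\<^sup>+ w. ennreal \<bar>fst w - snd w\<bar> \<partial>P) \<le> (\<integral>\<^sup>+ w. 1 + ennreal (\<bar>fst w - snd w\<bar> powr q) \<partial>P)"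
  proof (intro nn_integral_mono)
    fix w :: "real \<times> real"
    have "ennreal \<bar>fst w - snd w\<bar> \<le> ennreal (1 + \<bar>fst w - snd w\<bar> powr q)"
      by (intro ennreal_leI pw) simp
    thus "ennreal \<bar>fst w - snd w\<bar> \<le> 1 + ennreal (\<bar>fst w - snd w\<bar> powr q)"
      by (simp add: ennreal_plus)
  qed
  also have "\<dots> = 1 + (\<integral>\<^sup>+ w. ennreal (\<bar>fst w - snd w\<bar> powr q) \<partial>P)"
    by (subst nn_integral_add) (auto simp: emeasure_space_1)
  also have "\<dots> \<le> 1 + ennreal (c powr q)"
    using d False by (intro add_left_mono) (simp add: displacement_le_def q_def)
  also have "\<dots> = ennreal (1 + c powr q)" by (simp add: ennreal_plus)
  also have "\<dots> \<le> ennreal (1 + c + c powr enn2real p)"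
    by (intro ennreal_leI) (simp add: c q_def)
  finally show ?thesis .
qed

lemma prob_space_coupling:
  assumes "P \<in> couplings F G" "prob_space F"
  shows "prob_space P"
  using assms prob_space_distrD[of fst P borel] unfolding couplings_def
  by (auto cong: measurable_cong_sets)

text \<open>Given \<open>F\<close> near \<open>empirical N z\<close>, lift a coupling to indices and carry the displacements over to the
  atoms \<open>z'\<close>.  The coupling may cost up to \<open>\<epsilon> * (1 + \<rho>)\<close>, so the displacements are shrunk by the factor
  \<open>1 / (1 + \<rho>)\<close> to land in the ball around \<open>empirical N z'\<close>; as the mean displacement is bounded, the
  shrinking changes the risk by \<open>O(\<rho>)\<close>, which vanishes in the limit.\<close>

lemma worst_case_risk_lipschitz:
  fixes z z' :: "nat \<Rightarrow> real"
  assumes \<alpha>: "0 < \<alpha>" "\<alpha> < 1" and p: "1 \<le> p" and \<epsilon>: "0 < \<epsilon>" and N: "N \<ge> 1"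
  shows "worst_case_risk \<alpha> p (empirical N z) \<epsilon> s
           \<le> worst_case_risk \<alpha> p (empirical N z') \<epsilon> s' + ennreal ((\<Sum>i=1..N. \<bar>z' i - z i\<bar>) + \<bar>s' - s\<bar>)"
  unfolding worst_case_risk_def[of \<alpha> p "empirical N z"]
proof (rule SUP_least)
  fix F assume F: "F \<in> wball p (empirical N z) \<epsilon>"
  define C where "C = 1 + 2 * \<epsilon> + (2 * \<epsilon>) powr enn2real p"
  define D where "D = (\<Sum>i=1..N. \<bar>z' i - z i\<bar>) + \<bar>s' - s\<bar>"
  have C: "C > 0" unfolding C_def using \<epsilon> by (intro add_pos_nonneg) auto
  have D: "D \<ge> 0" unfolding D_def by (auto intro: sum_nonneg)
  have main: "risk \<alpha> s F \<le> worst_case_risk \<alpha> p (empirical N z') \<epsilon> s' + ennreal D + ennreal (\<rho> * C)"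
    if \<rho>: "0 < \<rho>" "\<rho> \<le> 1" for \<rho> :: real
  proof -
    define \<theta> where "\<theta> = 1 / (1 + \<rho>)"
    have \<theta>: "0 < \<theta>" "\<theta> \<le> 1" "1 - \<theta> \<le> \<rho>" "\<theta> * (\<epsilon> * (1 + \<rho>)) = \<epsilon>"
      using \<rho> by (auto simp: \<theta>_def field_simps)
    have "wasserstein p F (empirical N z) \<le> ennreal \<epsilon>" using F by (simp add: wball_def)
    also have "\<dots> < ennreal (\<epsilon> * (1 + \<rho>))" using \<epsilon> \<rho> by (intro ennreal_lessI) (auto simp: algebra_simps add_pos_pos)
    finally obtain P where P: "P \<in> couplings F (empirical N z)" and d: "displacement_le p P (\<epsilon> * (1 + \<rho>))"
      using p by (rule wasserstein_lessD)
    have probF: "prob_space F" using F by (simp add: wball_def)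
    have setsP [measurable_cong]: "sets P = sets (borel \<Otimes>\<^sub>M borel)"
      and Pfst: "distr P borel fst = F"
      using P by (auto simp: couplings_def)
    have probP: "prob_space P" using P probF by (rule prob_space_coupling)
    obtain K :: "((real \<times> real) \<times> nat) measure" where
      setsK [measurable_cong]: "sets K = sets ((borel \<Otimes>\<^sub>M borel) \<Otimes>\<^sub>M count_space UNIV)" and
      Kfst: "distr K (borel \<Otimes>\<^sub>M borel) fst = P" and
      Ksnd: "distr K (count_space UNIV) snd = measure_pmf (pmf_of_set {1..N})" and
      Kz: "AE w in K. snd (fst w) = z (snd w)"
      using coupling_with_empirical_lift[OF P N] by blast
    have [measurable]: "fst \<in> measurable K (borel \<Otimes>\<^sub>M borel)" "snd \<in> measurable K (count_space UNIV)"
      by measurable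
    define a b where "a = (\<lambda>w :: (real \<times> real) \<times> nat. fst (fst w))"
      and "b = (\<lambda>w :: (real \<times> real) \<times> nat. snd (fst w))"
    have [measurable]: "a \<in> borel_measurable K" "b \<in> borel_measurable K"
      unfolding a_def b_def
      by (auto intro!: measurable_compose[OF \<open>fst \<in> measurable K (borel \<Otimes>\<^sub>M borel)\<close>])
    have [measurable]: "(\<lambda>w. h (snd w)) \<in> borel_measurable K" for h :: "nat \<Rightarrow> real"
      by (rule measurable_compose[OF \<open>snd \<in> measurable K (count_space UNIV)\<close>]) simp
    have probK: "prob_space K"
      using probP Kfst by (metis \<open>fst \<in> measurable K (borel \<Otimes>\<^sub>M borel)\<close> prob_space_distrD)
    define a' where "a' = (\<lambda>w. z' (snd w) + \<theta> * (a w - b w))"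
    have [measurable]: "a' \<in> borel_measurable K" unfolding a'_def by measurable
    define F' where "F' = distr K borel a'"
    define P' where "P' = distr K (borel \<Otimes>\<^sub>M borel) (\<lambda>w. (a' w, z' (snd w)))"
    have "P' \<in> couplings F' (empirical N z')"
    proof -
      have "distr K borel (\<lambda>w. z' (snd w)) = empirical N z'"
        unfolding empirical_def Ksnd[symmetric] by (subst distr_distr) (auto simp: o_def)
      thus ?thesis by (auto simp: couplings_def P'_def F'_def distr_distr o_def)
    qed
    moreover have "displacement_le p P' \<epsilon>"
    proof (cases "p = \<top>")
      case True
      have "AE w in P. \<bar>fst w - snd w\<bar> \<le> \<epsilon> * (1 + \<rho>)"
        using d True by (simp add: displacement_le_def)
      hence "AE w in K. \<bar>a w - b w\<bar> \<le> \<epsilon> * (1 + \<rho>)"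
        unfolding Kfst[symmetric] by (subst (asm) AE_distr_iff) (auto simp: a_def b_def)
      hence "AE w in K. \<bar>a' w - z' (snd w)\<bar> \<le> \<epsilon>"
      proof eventually_elim
        case (elim w)
        hence "\<theta> * \<bar>a w - b w\<bar> \<le> \<theta> * (\<epsilon> * (1 + \<rho>))" using \<theta> by (intro mult_left_mono) auto
        thus ?case using \<theta> by (simp add: a'_def abs_mult)
      qed
      thus ?thesis unfolding displacement_le_def P'_def using True by (auto simp: AE_distr_iff)
    next
      case False
      define q where "q = enn2real p"
      have "(\<integral>\<^sup>+ w. ennreal (\<bar>fst w - snd w\<bar> powr q) \<partial>P') = (\<integral>\<^sup>+ w. ennreal (\<bar>a' w - z' (snd w)\<bar> powr q) \<partial>K)"
        unfolding P'_def by (subst nn_integral_distr) auto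
      also have "\<dots> = (\<integral>\<^sup>+ w. ennreal (\<theta> powr q) * ennreal (\<bar>a w - b w\<bar> powr q) \<partial>K)"
        using \<theta> by (intro nn_integral_cong) (simp add: a'_def abs_mult powr_mult ennreal_mult)
      also have "\<dots> = ennreal (\<theta> powr q) * (\<integral>\<^sup>+ w. ennreal (\<bar>a w - b w\<bar> powr q) \<partial>K)"
        by (rule nn_integral_cmult) measurable
      also have "(\<integral>\<^sup>+ w. ennreal (\<bar>a w - b w\<bar> powr q) \<partial>K) = (\<integral>\<^sup>+ w. ennreal (\<bar>fst w - snd w\<bar> powr q) \<partial>P)"
        unfolding Kfst[symmetric] by (subst nn_integral_distr) (auto simp: a_def b_def)
      also have "ennreal (\<theta> powr q) * \<dots> \<le> ennreal (\<theta> powr q) * ennreal ((\<epsilon> * (1 + \<rho>)) powr q)"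
        using d False by (intro mult_left_mono) (auto simp: displacement_le_def q_def)
      also have "\<dots> = ennreal ((\<theta> * (\<epsilon> * (1 + \<rho>))) powr q)"
        using \<theta> \<epsilon> \<rho> by (subst powr_mult) (auto simp: ennreal_mult)
      finally show ?thesis using False \<theta> by (simp add: displacement_le_def q_def)
    qed
    ultimately have "wasserstein p F' (empirical N z') \<le> ennreal \<epsilon>"
      using \<epsilon> p by (intro wasserstein_leI) auto
    hence "F' \<in> wball p (empirical N z') \<epsilon>"
      using prob_space.prob_space_distr[OF probK, of a' borel] by (simp add: wball_def F'_def)
    hence le: "risk \<alpha> s' F' \<le> worst_case_risk \<alpha> p (empirical N z') \<epsilon> s'"
      unfolding worst_case_risk_def by (rule SUP_upper)
    have "AE w in K. snd w \<in> {1..N}"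
    proof -
      have "AE i in distr K (count_space UNIV) snd. i \<in> {1..N}"
        unfolding Ksnd using N by (simp add: AE_measure_pmf_iff)
      thus ?thesis by (subst (asm) AE_distr_iff) auto
    qed
    hence pt: "AE w in K. ennreal (check_loss \<alpha> (a w - s))
        \<le> ennreal (check_loss \<alpha> (a' w - s')) + (ennreal D + ennreal \<rho> * ennreal \<bar>a w - b w\<bar>)"
      using Kz
    proof eventually_elim
      case (elim w)
      have "\<bar>z' (snd w) - z (snd w)\<bar> \<le> (\<Sum>i=1..N. \<bar>z' i - z i\<bar>)"
        using elim(1) by (intro member_le_sum) auto
      hence dz: "\<bar>z' (snd w) - z (snd w)\<bar> + \<bar>s' - s\<bar> \<le> D" by (simp add: D_def)
      have "(a w - s) - (a' w - s') = (1 - \<theta>) * (a w - b w) - (z' (snd w) - z (snd w)) + (s' - s)"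
        using elim(2) by (simp add: a'_def b_def algebra_simps)
      hence "\<bar>(a w - s) - (a' w - s')\<bar> \<le> \<bar>(1 - \<theta>) * (a w - b w)\<bar> + D" using dz by linarith
      also have "\<bar>(1 - \<theta>) * (a w - b w)\<bar> \<le> \<rho> * \<bar>a w - b w\<bar>"
        unfolding abs_mult using \<theta> by (intro mult_right_mono) auto
      finally have diff: "\<bar>(a w - s) - (a' w - s')\<bar> \<le> D + \<rho> * \<bar>a w - b w\<bar>" by simp
      have "check_loss \<alpha> (a w - s) \<le> check_loss \<alpha> (a' w - s') + max \<alpha> (1 - \<alpha>) * \<bar>(a w - s) - (a' w - s')\<bar>"
        by (rule check_loss_lipschitz[OF \<alpha>])
      also have "max \<alpha> (1 - \<alpha>) * \<bar>(a w - s) - (a' w - s')\<bar> \<le> 1 * (D + \<rho> * \<bar>a w - b w\<bar>)"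
        using diff \<alpha> by (intro mult_mono) auto
      finally have "ennreal (check_loss \<alpha> (a w - s)) \<le> ennreal (check_loss \<alpha> (a' w - s') + (D + \<rho> * \<bar>a w - b w\<bar>))"
        by (intro ennreal_leI) simp
      thus ?case using D \<rho> check_loss_nonneg[OF \<alpha>, of "a' w - s'"]
        by (simp add: ennreal_plus ennreal_mult)
    qed
    have "F = distr K borel a"
      unfolding Pfst[symmetric] Kfst[symmetric] by (subst distr_distr) (auto simp: a_def o_def)
    hence "risk \<alpha> s F = (\<integral>\<^sup>+ w. ennreal (check_loss \<alpha> (a w - s)) \<partial>K)"
      by (simp add: risk_distr)
    also have "\<dots> \<le> (\<integral>\<^sup>+ w. ennreal (check_loss \<alpha> (a' w - s')) + (ennreal D + ennreal \<rho> * ennreal \<bar>a w - b w\<bar>) \<partial>K)"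
      using pt by (rule nn_integral_mono_AE)
    also have "\<dots> = risk \<alpha> s' F' + (ennreal D + ennreal \<rho> * (\<integral>\<^sup>+ w. ennreal \<bar>a w - b w\<bar> \<partial>K))"
      unfolding F'_def using prob_space.emeasure_space_1[OF probK]
      by (simp add: risk_distr nn_integral_add nn_integral_cmult)
    also have "(\<integral>\<^sup>+ w. ennreal \<bar>a w - b w\<bar> \<partial>K) = (\<integral>\<^sup>+ w. ennreal \<bar>fst w - snd w\<bar> \<partial>P)"
      unfolding Kfst[symmetric] by (subst nn_integral_distr) (auto simp: a_def b_def)
    also have "risk \<alpha> s' F' + (ennreal D + ennreal \<rho> * \<dots>)
        \<le> worst_case_risk \<alpha> p (empirical N z') \<epsilon> s' + (ennreal D + ennreal \<rho> * ennreal C)"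
    proof (intro add_mono le mult_left_mono order_refl)
      have "(\<integral>\<^sup>+ w. ennreal \<bar>fst w - snd w\<bar> \<partial>P)
          \<le> ennreal (1 + \<epsilon> * (1 + \<rho>) + (\<epsilon> * (1 + \<rho>)) powr enn2real p)"
        using probP setsP d p \<epsilon> \<rho> by (intro mean_displacement_le) auto
      also have "\<dots> \<le> ennreal C"
        unfolding C_def using \<epsilon> \<rho> by (intro ennreal_leI add_mono powr_mono2) auto
      finally show "(\<integral>\<^sup>+ w. ennreal \<bar>fst w - snd w\<bar> \<partial>P) \<le> ennreal C" .
    qed simp
    finally show ?thesis using \<rho> C by (simp add: ennreal_mult add.assoc)
  qed
  show "risk \<alpha> s F \<le> worst_case_risk \<alpha> p (empirical N z') \<epsilon> s' + ennreal D"
  proof (rule ennreal_le_epsilon)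
    fix \<kappa> :: real assume \<kappa>: "0 < \<kappa>"
    define \<rho> where "\<rho> = min 1 (\<kappa> / C)"
    have \<rho>: "0 < \<rho>" "\<rho> \<le> 1" "\<rho> * C \<le> \<kappa>" using \<kappa> C by (auto simp: \<rho>_def min_def field_simps)
    have "risk \<alpha> s F \<le> worst_case_risk \<alpha> p (empirical N z') \<epsilon> s' + ennreal D + ennreal (\<rho> * C)"
      using main \<rho> by blast
    also have "\<dots> \<le> worst_case_risk \<alpha> p (empirical N z') \<epsilon> s' + ennreal D + ennreal \<kappa>"
      using \<rho> by (intro add_left_mono ennreal_leI)
    finally show "risk \<alpha> s F \<le> worst_case_risk \<alpha> p (empirical N z') \<epsilon> s' + ennreal D + ennreal \<kappa>" .
  qed
qed

text \<open>By the Lipschitz bound, the superlevel sets of the worst-case risk are open in the product topology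
  on the sequences whose entry \<open>0\<close> is \<open>s\<close> and whose entries \<open>1, \<dots>, N\<close> are the atoms.\<close>

lemma worst_case_risk_measurable:
  assumes \<alpha>: "0 < \<alpha>" "\<alpha> < 1" and p: "1 \<le> p" and \<epsilon>: "0 < \<epsilon>" and N: "N \<ge> 1"
    and z: "\<And>i. i \<in> {1..N} \<Longrightarrow> (\<lambda>\<omega>. z \<omega> i) \<in> borel_measurable M"
    and s: "s \<in> borel_measurable M"
  shows "(\<lambda>\<omega>. worst_case_risk \<alpha> p (empirical N (z \<omega>)) \<epsilon> (s \<omega>)) \<in> borel_measurable M"
proof -
  define H :: "(nat \<Rightarrow> real) \<Rightarrow> ennreal" where "H = (\<lambda>v. worst_case_risk \<alpha> p (empirical N v) \<epsilon> (v 0))"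
  have lip: "H v \<le> H v' + ennreal (\<Sum>i\<le>N. \<bar>v' i - v i\<bar>)" for v v'
  proof -
    have "(\<Sum>i\<le>N. \<bar>v' i - v i\<bar>) = (\<Sum>i=1..N. \<bar>v' i - v i\<bar>) + \<bar>v' 0 - v 0\<bar>"
      using sum.atLeast_Suc_atMost[of 0 N "\<lambda>i. \<bar>v' i - v i\<bar>"]
      by (simp add: atMost_atLeast0)
    thus ?thesis unfolding H_def using worst_case_risk_lipschitz[OF \<alpha> p \<epsilon> N] by metis
  qed
  have "open {v. y < H v}" for y
  proof (subst open_subopen, safe)
    fix v assume v: "y < H v"
    then obtain \<kappa> :: real where \<kappa>: "0 < \<kappa>" "y + ennreal \<kappa> < H v"
    proof -
      obtain y' where y': "y < y'" "y' < H v" using dense[OF v] by auto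
      show ?thesis
      proof (rule that)
        have fin: "y \<noteq> \<top>" "y' \<noteq> \<top>" using y' by auto
        hence *: "y = ennreal (enn2real y)" "y' = ennreal (enn2real y')" by (auto simp: ennreal_enn2real less_top)
        show pos: "0 < enn2real y' - enn2real y"
          using y'(1) * by (metis diff_gt_0_iff_gt enn2real_nonneg ennreal_less_iff)
        have "y + ennreal (enn2real y' - enn2real y) = y'"
          using * pos by (metis add_diff_cancel_left' diff_add_cancel add.commute enn2real_nonneg ennreal_plus less_imp_le)
        thus "y + ennreal (enn2real y' - enn2real y) < H v" using y' by simp
      qed
    qed
    define T where "T = {v' :: nat \<Rightarrow> real. (\<Sum>i\<le>N. \<bar>v' i - v i\<bar>) < \<kappa>}"
    have "open T" unfolding T_def
      by (intro open_Collect_less continuous_intros continuous_on_product_coordinates)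
    moreover have "v \<in> T" using \<kappa> by (simp add: T_def)
    moreover have "T \<subseteq> {v. y < H v}"
    proof (rule subsetI, rule CollectI, rule ccontr)
      fix v' assume v': "v' \<in> T" "\<not> y < H v'"
      have "H v \<le> H v' + ennreal (\<Sum>i\<le>N. \<bar>v' i - v i\<bar>)" by (rule lip)
      also have "\<dots> \<le> y + ennreal \<kappa>" using v' by (intro add_mono ennreal_leI) (auto simp: T_def)
      finally show False using \<kappa>(2) by simp
    qed
    ultimately show "\<exists>T. open T \<and> v \<in> T \<and> T \<subseteq> {v. y < H v}" by blast
  qed
  hence H: "H \<in> borel_measurable borel"
    by (intro borel_measurableI_greater) simp
  define V where "V = (\<lambda>\<omega> i. if i = 0 then s \<omega> else if i \<le> N then z \<omega> i else 0)"
  have "V \<in> borel_measurable M"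
  proof (rule measurable_coordinatewise_then_product)
    fix i show "(\<lambda>\<omega>. V \<omega> i) \<in> borel_measurable M"
      unfolding V_def using s z[of i] by (cases "i = 0"; cases "i \<le> N") auto
  qed
  hence "(\<lambda>\<omega>. H (V \<omega>)) \<in> borel_measurable M" using H by (rule measurable_compose)
  moreover have "H (V \<omega>) = worst_case_risk \<alpha> p (empirical N (z \<omega>)) \<epsilon> (s \<omega>)" for \<omega>
  proof -
    have "empirical N (V \<omega>) = empirical N (z \<omega>)"
      unfolding empirical_def using N by (intro measure_eqI)
        (auto simp: emeasure_distr emeasure_pmf_of_set V_def intro!: arg_cong[where f = card])
    thus ?thesis by (simp add: H_def V_def)
  qed
  ultimately show ?thesis by simp
qed

section \<open>Risk and distribution functions\<close>

lemma check_loss_layer_cake: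
  assumes \<alpha>: "0 < \<alpha>" "\<alpha> < 1"
  shows "ennreal (check_loss \<alpha> (\<xi> - s)) = (\<integral>\<^sup>+ t. (if s \<le> t then ennreal \<alpha> * indicator {t<..} \<xi>
           else ennreal (1 - \<alpha>) * indicator {..t} \<xi>) \<partial>lborel)"
proof (cases "s \<le> \<xi>")
  case True
  have "(\<integral>\<^sup>+ t. (if s \<le> t then ennreal \<alpha> * indicator {t<..} \<xi>
           else ennreal (1 - \<alpha>) * indicator {..t} \<xi>) \<partial>lborel)
        = (\<integral>\<^sup>+ t. ennreal \<alpha> * indicator {s..<\<xi>} t \<partial>lborel)"
    using True by (intro nn_integral_cong) (auto simp: indicator_def)
  also have "\<dots> = ennreal \<alpha> * ennreal (\<xi> - s)"
    using True by (subst nn_integral_cmult_indicator) auto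
  also have "\<dots> = ennreal (check_loss \<alpha> (\<xi> - s))"
    using True \<alpha> by (simp add: check_loss_def mult.commute flip: ennreal_mult)
  finally show ?thesis by simp
next
  case False
  have "(\<integral>\<^sup>+ t. (if s \<le> t then ennreal \<alpha> * indicator {t<..} \<xi>
           else ennreal (1 - \<alpha>) * indicator {..t} \<xi>) \<partial>lborel)
        = (\<integral>\<^sup>+ t. ennreal (1 - \<alpha>) * indicator {\<xi>..<s} t \<partial>lborel)"
    using False by (intro nn_integral_cong) (auto simp: indicator_def)
  also have "\<dots> = ennreal (1 - \<alpha>) * ennreal (s - \<xi>)"
    using False by (subst nn_integral_cmult_indicator) auto
  also have "\<dots> = ennreal (check_loss \<alpha> (\<xi> - s))"
    using False \<alpha> by (simp add: check_loss_def flip: ennreal_mult) (simp add: algebra_simps)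
  finally show ?thesis by simp
qed

lemma cdf_measurable:
  assumes "prob_space F" "sets F = sets borel"
  shows "(\<lambda>t :: real. measure F {..t}) \<in> borel_measurable borel"
proof -
  interpret prob_space F by fact
  show ?thesis
    by (intro borel_measurable_mono monoI finite_measure_mono) (auto simp: assms(2))
qed

text \<open>Layer cake: the loss at \<open>\<xi> - s\<close> integrates the slope of the loss between \<open>s\<close> and \<open>\<xi>\<close>, and Tonelli's
  theorem exchanges this integral with the expectation.\<close>

lemma risk_eq_tail_integral:
  assumes \<alpha>: "0 < \<alpha>" "\<alpha> < 1" and F: "prob_space F" and setsF [measurable_cong]: "sets F = sets borel"
  shows "risk \<alpha> s F = (\<integral>\<^sup>+ t. ennreal (if s \<le> t then \<alpha> * (1 - measure F {..t}) else (1 - \<alpha>) * measure F {..t}) \<partial>lborel)"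
proof -
  interpret F: prob_space F by fact
  interpret pair_sigma_finite lborel F ..
  let ?g = "\<lambda>t \<xi> :: real. if s \<le> t then ennreal \<alpha> * indicator {t<..} \<xi> else ennreal (1 - \<alpha>) * indicator {..t} \<xi>"
  have g: "?g = (\<lambda>t \<xi>. if s \<le> t then (if t < \<xi> then ennreal \<alpha> else 0) else (if \<xi> \<le> t then ennreal (1 - \<alpha>) else 0))"
    by (auto simp: fun_eq_iff indicator_def)
  have [measurable]: "(\<lambda>(t, \<xi>). ?g t \<xi>) \<in> borel_measurable (lborel \<Otimes>\<^sub>M F)"
    unfolding g by measurable
  have "risk \<alpha> s F = (\<integral>\<^sup>+ \<xi>. (\<integral>\<^sup>+ t. ?g t \<xi> \<partial>lborel) \<partial>F)"
    unfolding risk_def by (simp add: check_loss_layer_cake[OF \<alpha>])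
  also have "\<dots> = (\<integral>\<^sup>+ t. (\<integral>\<^sup>+ \<xi>. ?g t \<xi> \<partial>F) \<partial>lborel)"
    by (rule Fubini') measurable
  also have "\<dots> = (\<integral>\<^sup>+ t. ennreal (if s \<le> t then \<alpha> * (1 - measure F {..t}) else (1 - \<alpha>) * measure F {..t}) \<partial>lborel)"
  proof (intro nn_integral_cong)
    fix t :: real
    have "{t<..} = space F - {..t}" using setsF sets_eq_imp_space_eq[OF setsF] by auto
    hence "measure F {t<..} = 1 - measure F {..t}"
      using F.prob_compl[of "{..t}"] by (simp add: setsF)
    thus "(\<integral>\<^sup>+ \<xi>. ?g t \<xi> \<partial>F) = ennreal (if s \<le> t then \<alpha> * (1 - measure F {..t}) else (1 - \<alpha>) * measure F {..t})"
      using \<alpha> by (auto simp: nn_integral_cmult_indicator setsF F.emeasure_eq_measure ennreal_mult)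
  qed
  finally show ?thesis .
qed

text \<open>In the layer-cake formula the distribution enters only through its distribution function, with
  weights at most \<open>max \<alpha> (1 - \<alpha>)\<close>.  The bound is therefore uniform in \<open>s\<close>, which may depend on the
  sample.\<close>

lemma risk_le_risk_plus_cdf_distance:
  assumes \<alpha>: "0 < \<alpha>" "\<alpha> < 1"
    and F: "prob_space F" "sets F = sets borel" and G: "prob_space G" "sets G = sets borel"
  shows "risk \<alpha> s F \<le> risk \<alpha> s G +
           ennreal (max \<alpha> (1 - \<alpha>)) * (\<integral>\<^sup>+ t. ennreal \<bar>measure G {..t} - measure F {..t}\<bar> \<partial>lborel)"
proof -
  note [measurable] = cdf_measurable[OF F] cdf_measurable[OF G]
  let ?L = "max \<alpha> (1 - \<alpha>)"
  let ?k = "\<lambda>F t. if s \<le> t then \<alpha> * (1 - measure F {..t}) else (1 - \<alpha>) * measure F {..t}"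
  have nn: "0 \<le> ?k G t" for t
    using \<alpha> prob_space.prob_le_1[OF G(1)] by auto
  have "?k F t \<le> ?k G t + ?L * \<bar>measure G {..t} - measure F {..t}\<bar>" for t
  proof -
    define d where "d = measure G {..t} - measure F {..t}"
    have "\<alpha> * d \<le> ?L * \<bar>d\<bar>" "(1 - \<alpha>) * (- d) \<le> ?L * \<bar>d\<bar>"
      by (rule order_trans[OF mult_left_mono mult_right_mono]; use \<alpha> in auto)+
    thus ?thesis by (auto simp: d_def algebra_simps)
  qed
  hence "risk \<alpha> s F \<le> (\<integral>\<^sup>+ t. ennreal (?k G t + ?L * \<bar>measure G {..t} - measure F {..t}\<bar>) \<partial>lborel)"
    unfolding risk_eq_tail_integral[OF \<alpha> F] by (intro nn_integral_mono ennreal_leI)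
  also have "\<dots> = (\<integral>\<^sup>+ t. ennreal (?k G t) + ennreal ?L * ennreal \<bar>measure G {..t} - measure F {..t}\<bar> \<partial>lborel)"
    using nn \<alpha> by (intro nn_integral_cong) (simp add: ennreal_plus ennreal_mult)
  also have "\<dots> = risk \<alpha> s G + ennreal ?L * (\<integral>\<^sup>+ t. ennreal \<bar>measure G {..t} - measure F {..t}\<bar> \<partial>lborel)"
    unfolding risk_eq_tail_integral[OF \<alpha> G]
    by (subst nn_integral_add) (auto simp: nn_integral_cmult)
  finally show ?thesis .
qed

lemma measure_empirical_atMost:
  assumes "N \<ge> 1"
  shows "measure (empirical N z) {..t} = (\<Sum>i=1..N. indicator {..t} (z i)) / real N"
proof -
  have "measure (empirical N z) {..t} = measure (measure_pmf (pmf_of_set {1..N})) {i. z i \<le> t}"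
    unfolding empirical_def by (subst measure_distr) (auto intro!: arg_cong[where f = "measure _"])
  also have "\<dots> = real (card ({1..N} \<inter> {i. z i \<le> t})) / real N"
    using assms by (subst measure_pmf_of_set) auto
  also have "real (card ({1..N} \<inter> {i. z i \<le> t})) = (\<Sum>i=1..N. indicator {..t} (z i))"
    by (simp add: indicator_def sum.If_cases)
  finally show ?thesis .
qed

lemma risk_target_le:
  assumes \<alpha>: "0 < \<alpha>" "\<alpha> < 1" and F: "prob_space F" "sets F = sets borel"
  shows "risk \<alpha> s (target_dist F \<beta> b c) \<le> risk \<alpha> s F + ennreal (max \<alpha> (1 - \<alpha>) * \<bar>(\<beta> - b) \<bullet> c\<bar>)"
proof -
  interpret F: prob_space F by fact
  note [measurable_cong] = F(2)
  let ?u = "max \<alpha> (1 - \<alpha>) * \<bar>(\<beta> - b) \<bullet> c\<bar>"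
  have "risk \<alpha> s (target_dist F \<beta> b c) = (\<integral>\<^sup>+ \<xi>. ennreal (check_loss \<alpha> (\<xi> + (\<beta> - b) \<bullet> c - s)) \<partial>F)"
    unfolding target_dist_def by (rule risk_distr) measurable
  also have "\<dots> \<le> (\<integral>\<^sup>+ \<xi>. ennreal (check_loss \<alpha> (\<xi> - s)) + ennreal ?u \<partial>F)"
  proof (intro nn_integral_mono)
    fix \<xi>
    have "check_loss \<alpha> (\<xi> + (\<beta> - b) \<bullet> c - s) \<le> check_loss \<alpha> (\<xi> - s) + ?u"
      using check_loss_lipschitz[OF \<alpha>, of "\<xi> + (\<beta> - b) \<bullet> c - s" "\<xi> - s"] by (simp add: algebra_simps)
    hence "ennreal (check_loss \<alpha> (\<xi> + (\<beta> - b) \<bullet> c - s)) \<le> ennreal (check_loss \<alpha> (\<xi> - s) + ?u)"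
      by (rule ennreal_leI)
    also have "\<dots> = ennreal (check_loss \<alpha> (\<xi> - s)) + ennreal ?u"
      using \<alpha> by (intro ennreal_plus) (auto simp: check_loss_nonneg le_max_iff_disj)
    finally show "ennreal (check_loss \<alpha> (\<xi> + (\<beta> - b) \<bullet> c - s)) \<le> \<dots>" .
  qed
  also have "\<dots> = risk \<alpha> s F + ennreal ?u"
    unfolding risk_def by (subst nn_integral_add) (auto simp: F.emeasure_space_1)
  finally show ?thesis .
qed

lemma risk_empirical_perturb:
  assumes \<alpha>: "0 < \<alpha>" "\<alpha> < 1" and N: "N \<ge> 1"
  shows "risk \<alpha> s (empirical N z) \<le> risk \<alpha> s (empirical N z') +
           ennreal (max \<alpha> (1 - \<alpha>) * ((\<Sum>i=1..N. \<bar>z i - z' i\<bar>) / real N))"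
proof -
  let ?L = "max \<alpha> (1 - \<alpha>)"
  have avg: "risk \<alpha> s (empirical N z) = ennreal ((\<Sum>i=1..N. check_loss \<alpha> (z i - s)) / real N)" for z
    using N by (simp add: risk_empirical sum_ennreal check_loss_nonneg[OF \<alpha>] sum_nonneg
        ennreal_of_nat_eq_real_of_nat divide_ennreal)
  have "(\<Sum>i=1..N. check_loss \<alpha> (z i - s)) \<le> (\<Sum>i=1..N. check_loss \<alpha> (z' i - s) + ?L * \<bar>z i - z' i\<bar>)"
    using check_loss_lipschitz[OF \<alpha>, of "z _ - s" "z' _ - s"] by (intro sum_mono) simp
  also have "\<dots> = (\<Sum>i=1..N. check_loss \<alpha> (z' i - s)) + ?L * (\<Sum>i=1..N. \<bar>z i - z' i\<bar>)"
    by (simp add: sum.distrib sum_distrib_left)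
  finally have "(\<Sum>i=1..N. check_loss \<alpha> (z i - s)) / real N
      \<le> ((\<Sum>i=1..N. check_loss \<alpha> (z' i - s)) + ?L * (\<Sum>i=1..N. \<bar>z i - z' i\<bar>)) / real N"
    by (intro divide_right_mono) auto
  also have "\<dots> = (\<Sum>i=1..N. check_loss \<alpha> (z' i - s)) / real N + ?L * ((\<Sum>i=1..N. \<bar>z i - z' i\<bar>) / real N)"
    by (simp add: add_divide_distrib)
  finally show ?thesis unfolding avg using \<alpha>
    by (subst ennreal_plus[symmetric])
       (auto intro!: ennreal_leI divide_nonneg_nonneg sum_nonneg mult_nonneg_nonneg check_loss_nonneg[OF \<alpha>])
qed

section \<open>The empirical distribution function at a point\<close>

lemma (in prob_space) second_moment_indep_sum:
  fixes X :: "nat \<Rightarrow> 'a \<Rightarrow> real"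
  assumes "finite I" "indep_vars (\<lambda>_. borel) X I"
    and "\<And>i. i \<in> I \<Longrightarrow> integrable M (\<lambda>\<omega>. (X i \<omega>)\<^sup>2)"
    and "\<And>i. i \<in> I \<Longrightarrow> expectation (X i) = 0"
  shows "integrable M (\<lambda>\<omega>. (\<Sum>i\<in>I. X i \<omega>)\<^sup>2)"
    and "expectation (\<lambda>\<omega>. (\<Sum>i\<in>I. X i \<omega>)\<^sup>2) = (\<Sum>i\<in>I. expectation (\<lambda>\<omega>. (X i \<omega>)\<^sup>2))"
proof -
  have "integrable M (\<lambda>\<omega>. (\<Sum>i\<in>I. X i \<omega>)\<^sup>2) \<and>
    expectation (\<lambda>\<omega>. (\<Sum>i\<in>I. X i \<omega>)\<^sup>2) = (\<Sum>i\<in>I. expectation (\<lambda>\<omega>. (X i \<omega>)\<^sup>2))"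
    using assms
  proof (induction I)
    case (insert j I)
    define S where "S = (\<lambda>\<omega>. \<Sum>i\<in>I. X i \<omega>)"
    have rv [measurable]: "X i \<in> borel_measurable M" if "i \<in> insert j I" for i
      using insert.prems(1) that unfolding indep_vars_def by blast
    have Xint: "integrable M (X i)" if "i \<in> insert j I" for i
      using rv[OF that] insert.prems(2)[OF that] by (rule square_integrable_imp_integrable)
    have IH: "integrable M (\<lambda>\<omega>. (S \<omega>)\<^sup>2)"
        "expectation (\<lambda>\<omega>. (S \<omega>)\<^sup>2) = (\<Sum>i\<in>I. expectation (\<lambda>\<omega>. (X i \<omega>)\<^sup>2))"
      using insert.IH indep_vars_subset[OF insert.prems(1), of I] insert.prems
      unfolding S_def by auto
    have Sint: "integrable M S" and ES: "expectation S = 0"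
      unfolding S_def using Xint insert.prems(3) by (auto simp: Bochner_Integration.integral_sum)
    have ind: "indep_var borel (X j) borel S"
      unfolding S_def by (rule indep_vars_sum[OF insert.hyps insert.prems(1)])
    have XS: "integrable M (\<lambda>\<omega>. X j \<omega> * S \<omega>)" "expectation (\<lambda>\<omega>. X j \<omega> * S \<omega>) = 0"
      using indep_var_integrable[OF ind] indep_var_lebesgue_integral[OF ind] Xint Sint ES by auto
    have eq: "(\<lambda>\<omega>. (\<Sum>i\<in>insert j I. X i \<omega>)\<^sup>2) = (\<lambda>\<omega>. (X j \<omega>)\<^sup>2 + 2 * (X j \<omega> * S \<omega>) + (S \<omega>)\<^sup>2)"
      using insert.hyps by (auto simp: S_def fun_eq_iff power2_sum)
    show ?case unfolding eq using insert XS IH by auto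
  qed auto
  thus "integrable M (\<lambda>\<omega>. (\<Sum>i\<in>I. X i \<omega>)\<^sup>2)"
    "expectation (\<lambda>\<omega>. (\<Sum>i\<in>I. X i \<omega>)\<^sup>2) = (\<Sum>i\<in>I. expectation (\<lambda>\<omega>. (X i \<omega>)\<^sup>2))" by auto
qed

text \<open>Hoeffding's lemma for each summand; the interval length is \<open>1\<close> because the summands will be
  centred indicators.\<close>

lemma (in prob_space) mgf_indep_sum_le:
  fixes X :: "nat \<Rightarrow> 'a \<Rightarrow> real"
  assumes I: "finite I" and indep: "indep_vars (\<lambda>_. borel) X I"
    and range: "\<And>i \<omega>. i \<in> I \<Longrightarrow> \<omega> \<in> space M \<Longrightarrow> X i \<omega> \<in> {a..a + 1}"
    and mean: "\<And>i. i \<in> I \<Longrightarrow> expectation (X i) = 0" and l: "l > 0"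
  shows "(\<integral>\<^sup>+ \<omega>. ennreal (exp (l * (\<Sum>i\<in>I. X i \<omega>))) \<partial>M) \<le> ennreal (exp (real (card I) * l\<^sup>2 / 8))"
proof -
  have rv [measurable]: "X i \<in> borel_measurable M" if "i \<in> I" for i
    using indep that unfolding indep_vars_def by blast
  have "(\<integral>\<^sup>+ \<omega>. ennreal (exp (l * (\<Sum>i\<in>I. X i \<omega>))) \<partial>M) = (\<integral>\<^sup>+ \<omega>. (\<Prod>i\<in>I. ennreal (exp (l * X i \<omega>))) \<partial>M)"
    by (intro nn_integral_cong) (simp add: sum_distrib_left exp_sum I prod_ennreal)
  also have "\<dots> = (\<Prod>i\<in>I. \<integral>\<^sup>+ \<omega>. ennreal (exp (l * X i \<omega>)) \<partial>M)"
    by (intro indep_vars_nn_integral I indep_vars_compose2[OF indep]) auto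
  also have "\<dots> \<le> (\<Prod>i\<in>I. ennreal (exp (l\<^sup>2 / 8)))"
  proof (rule prod_mono_ennreal)
    fix i assume i: "i \<in> I"
    interpret interval_bounded_random_variable M "X i" a "a + 1"
      by unfold_locales (use rv range i in auto)
    show "(\<integral>\<^sup>+ \<omega>. ennreal (exp (l * X i \<omega>)) \<partial>M) \<le> ennreal (exp (l\<^sup>2 / 8))"
      using Hoeffdings_lemma_nn_integral_0[OF l mean[OF i]] by simp
  qed
  also have "\<dots> = ennreal (exp (real (card I) * l\<^sup>2 / 8))"
    by (simp add: ennreal_power flip: exp_of_nat_mult)
  finally show ?thesis .
qed

text \<open>Markov's inequality in the form in which it is combined below: outside an event of probability at
  most \<open>\<delta>\<close>, the function is at most \<open>t\<close>.  The case \<open>t = 0\<close> covers degenerate error distributions.\<close>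

lemma (in prob_space) Markov_exceptional_event:
  assumes [measurable]: "f \<in> borel_measurable M" and le: "(\<integral>\<^sup>+ \<omega>. f \<omega> \<partial>M) \<le> ennreal (\<delta> * t)"
    and t: "0 \<le> t" and \<delta>: "0 \<le> \<delta>"
  obtains A where "A \<in> events" "prob A \<le> \<delta>" "\<And>\<omega>. \<omega> \<in> space M - A \<Longrightarrow> f \<omega> \<le> ennreal t"
proof
  let ?A = "{\<omega> \<in> space M. ennreal t < f \<omega>}"
  show "?A \<in> events" by measurable
  show "f \<omega> \<le> ennreal t" if "\<omega> \<in> space M - ?A" for \<omega> using that by auto
  show "prob ?A \<le> \<delta>"
  proof (cases "t = 0")
    case True
    hence "(\<integral>\<^sup>+ \<omega>. f \<omega> \<partial>M) = 0" using le by simp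
    hence "AE \<omega> in M. f \<omega> = 0" by (subst (asm) nn_integral_0_iff_AE) auto
    hence "prob ?A = 0" using True by (subst prob_eq_0) auto
    thus ?thesis using \<delta> by simp
  next
    case False
    hence t0: "0 < t" using t by simp
    have "emeasure M ?A \<le> emeasure M {\<omega> \<in> space M. 1 \<le> ennreal (1 / t) * f \<omega>}"
    proof (rule emeasure_mono)
      show "?A \<subseteq> {\<omega> \<in> space M. 1 \<le> ennreal (1 / t) * f \<omega>}"
      proof safe
        fix \<omega> assume "ennreal t < f \<omega>"
        hence "ennreal (1 / t) * ennreal t \<le> ennreal (1 / t) * f \<omega>" by (intro mult_left_mono) auto
        thus "1 \<le> ennreal (1 / t) * f \<omega>" using t0 by (simp flip: ennreal_mult)
      qed
    qed measurable
    also have "\<dots> \<le> ennreal (1 / t) * (\<integral>\<^sup>+ \<omega>. f \<omega> * indicator (space M) \<omega> \<partial>M)"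
      by (rule nn_integral_Markov_inequality) auto
    also have "(\<integral>\<^sup>+ \<omega>. f \<omega> * indicator (space M) \<omega> \<partial>M) = (\<integral>\<^sup>+ \<omega>. f \<omega> \<partial>M)"
      by (intro nn_integral_cong) auto
    also have "ennreal (1 / t) * \<dots> \<le> ennreal (1 / t) * ennreal (\<delta> * t)"
      using le by (rule mult_left_mono) simp
    also have "\<dots> = ennreal \<delta>" using t0 \<delta> by (simp flip: ennreal_mult)
    finally show ?thesis using \<delta> by (simp add: emeasure_eq_measure)
  qed
qed

locale iid_sample = prob_space M for M :: "'a measure" +
  fixes e :: "nat \<Rightarrow> 'a \<Rightarrow> real" and F :: "real measure" and N :: nat
  assumes indep: "indep_vars (\<lambda>_. borel) e {1..N}"
    and distr_e: "\<And>i. i \<in> {1..N} \<Longrightarrow> distr M borel (e i) = F"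
    and N_pos: "N \<ge> 1"
begin

lemma rv_e: "i \<in> {1..N} \<Longrightarrow> e i \<in> borel_measurable M"
  using indep unfolding indep_vars_def by blast

lemma sets_F [simp, measurable_cong]: "sets F = sets borel"
  using distr_e[of 1] N_pos by auto

lemma space_F [simp]: "space F = UNIV"
  using sets_eq_imp_space_eq[OF sets_F] by simp

lemma prob_space_F: "prob_space F"
  using prob_space_distr[OF rv_e[of 1]] distr_e[of 1] N_pos by auto

lemma expectation_e:
  assumes "i \<in> {1..N}" "f \<in> borel_measurable borel"
  shows "expectation (\<lambda>\<omega>. f (e i \<omega>)) = (\<integral>u. f u \<partial>F :: real)"
  using integral_distr[OF rv_e[OF assms(1)] assms(2)] distr_e[OF assms(1)] by simp

lemma integrable_e:
  assumes "i \<in> {1..N}" "f \<in> borel_measurable borel"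
  shows "integrable M (\<lambda>\<omega>. f (e i \<omega>) :: real) \<longleftrightarrow> integrable F f"
  using integrable_distr_eq[OF rv_e[OF assms(1)] assms(2)] distr_e[OF assms(1)] by simp

definition cdf_error :: "real \<Rightarrow> 'a \<Rightarrow> real" where
  "cdf_error t \<omega> = \<bar>(\<Sum>i=1..N. indicator {..t} (e i \<omega>)) / real N - measure F {..t}\<bar>"

definition centered :: "real \<Rightarrow> nat \<Rightarrow> 'a \<Rightarrow> real" where
  "centered t i \<omega> = indicator {..t} (e i \<omega>) - measure F {..t}"

lemma cdf_error_centered: "cdf_error t \<omega> = \<bar>\<Sum>i=1..N. centered t i \<omega>\<bar> / real N"
proof -
  have "(\<Sum>i=1..N. centered t i \<omega>) = (\<Sum>i=1..N. indicator {..t} (e i \<omega>)) - real N * measure F {..t}"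
    by (simp add: centered_def sum_subtractf)
  hence "(\<Sum>i=1..N. centered t i \<omega>) / real N = (\<Sum>i=1..N. indicator {..t} (e i \<omega>)) / real N - measure F {..t}"
    using N_pos by (simp add: diff_divide_distrib)
  thus ?thesis unfolding cdf_error_def by (metis abs_divide abs_of_nat)
qed

lemma indep_centered: "indep_vars (\<lambda>_. borel) (centered t) {1..N}"
  unfolding centered_def
  by (rule indep_vars_compose2[OF indep, of "\<lambda>i u. indicator {..t} u - measure F {..t}"]) measurable

lemma expectation_centered:
  assumes "i \<in> {1..N}"
  shows "expectation (centered t i) = 0"
    and "expectation (\<lambda>\<omega>. (centered t i \<omega>)\<^sup>2) = measure F {..t} * (1 - measure F {..t})"
    and "integrable M (\<lambda>\<omega>. (centered t i \<omega>)\<^sup>2)"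
proof -
  interpret F: prob_space F by (rule prob_space_F)
  let ?m = "measure F {..t}"
  have [simp]: "measure F UNIV = 1" using F.prob_space by simp
  have int: "integrable F (indicator {..t} :: real \<Rightarrow> real)" by (simp add: F.emeasure_eq_measure)
  have "expectation (centered t i) = (\<integral>u. indicator {..t} u - ?m \<partial>F)"
    unfolding centered_def by (rule expectation_e[OF assms]) measurable
  also have "\<dots> = 0" using int by (simp add: F.prob_space)
  finally show "expectation (centered t i) = 0" .
  have sq: "(\<lambda>u. (indicator {..t} u - ?m)\<^sup>2) = (\<lambda>u :: real. (1 - 2 * ?m) * indicator {..t} u + ?m\<^sup>2)"
    by (auto simp: fun_eq_iff indicator_def power2_eq_square algebra_simps)
  have "expectation (\<lambda>\<omega>. (centered t i \<omega>)\<^sup>2) = (\<integral>u. (indicator {..t} u - ?m)\<^sup>2 \<partial>F)"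
    unfolding centered_def by (rule expectation_e[OF assms]) measurable
  also have "\<dots> = ?m * (1 - ?m)"
    unfolding sq using int by (simp add: F.prob_space power2_eq_square algebra_simps)
  finally show "expectation (\<lambda>\<omega>. (centered t i \<omega>)\<^sup>2) = ?m * (1 - ?m)" .
  have "integrable F (\<lambda>u. (indicator {..t} u - ?m)\<^sup>2)"
    unfolding sq using int by simp
  thus "integrable M (\<lambda>\<omega>. (centered t i \<omega>)\<^sup>2)"
    unfolding centered_def by (subst integrable_e[OF assms]) auto
qed

lemma cdf_error_second_moment:
  "(\<integral>\<^sup>+ \<omega>. ennreal ((cdf_error t \<omega>)\<^sup>2) \<partial>M) = ennreal (measure F {..t} * (1 - measure F {..t}) / real N)"
proof -
  have sm: "integrable M (\<lambda>\<omega>. (\<Sum>i=1..N. centered t i \<omega>)\<^sup>2)"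
    "expectation (\<lambda>\<omega>. (\<Sum>i=1..N. centered t i \<omega>)\<^sup>2) = (\<Sum>i=1..N. expectation (\<lambda>\<omega>. (centered t i \<omega>)\<^sup>2))"
    by (rule second_moment_indep_sum[OF finite_atLeastAtMost indep_centered expectation_centered(3,1)]; assumption)+
  have sq: "(\<lambda>\<omega>. (cdf_error t \<omega>)\<^sup>2) = (\<lambda>\<omega>. (\<Sum>i=1..N. centered t i \<omega>)\<^sup>2 / (real N)\<^sup>2)"
    by (simp add: cdf_error_centered power_divide)
  have int: "integrable M (\<lambda>\<omega>. (cdf_error t \<omega>)\<^sup>2)" unfolding sq using sm(1) by simp
  have "(\<integral>\<^sup>+ \<omega>. ennreal ((cdf_error t \<omega>)\<^sup>2) \<partial>M) = ennreal (expectation (\<lambda>\<omega>. (cdf_error t \<omega>)\<^sup>2))"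
    by (intro nn_integral_eq_integral int) auto
  also have "expectation (\<lambda>\<omega>. (cdf_error t \<omega>)\<^sup>2) = (\<Sum>i=1..N. measure F {..t} * (1 - measure F {..t})) / (real N)\<^sup>2"
    unfolding sq using sm(2) by (simp add: expectation_centered(2))
  also have "\<dots> = measure F {..t} * (1 - measure F {..t}) / real N"
    using N_pos by (simp add: power2_eq_square)
  finally show ?thesis .
qed

text \<open>The absolute value is handled by \<open>exp \<bar>u\<bar> \<le> exp u + exp (- u)\<close>, hence the factor \<open>2\<close>.\<close>

lemma cdf_error_mgf:
  assumes \<kappa>: "\<kappa> > 0"
  shows "(\<integral>\<^sup>+ \<omega>. ennreal (exp (\<kappa> * sqrt (real N) * cdf_error t \<omega>)) \<partial>M) \<le> ennreal (2 * exp (\<kappa>\<^sup>2 / 8))"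
proof -
  interpret F: prob_space F by (rule prob_space_F)
  define l where "l = \<kappa> / sqrt (real N)"
  have l: "l > 0" using \<kappa> N_pos by (simp add: l_def)
  have l2: "real N * l\<^sup>2 = \<kappa>\<^sup>2" using N_pos by (simp add: l_def power_divide)
  let ?S = "\<lambda>\<omega>. \<Sum>i=1..N. centered t i \<omega>"
  let ?m = "measure F {..t}"
  have [measurable]: "centered t i \<in> borel_measurable M" if "i \<in> {1..N}" for i
    using indep_centered[of t] that unfolding indep_vars_def by blast
  have S [measurable]: "?S \<in> borel_measurable M" by (rule borel_measurable_sum) simp
  have up: "(\<integral>\<^sup>+ \<omega>. ennreal (exp (l * ?S \<omega>)) \<partial>M) \<le> ennreal (exp (real (card {1..N}) * l\<^sup>2 / 8))"
    by (rule mgf_indep_sum_le[OF _ indep_centered, where a = "- ?m"])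
       (auto simp: expectation_centered l centered_def indicator_def)
  have "indep_vars (\<lambda>_. borel) (\<lambda>i \<omega>. - centered t i \<omega>) {1..N}"
    by (rule indep_vars_compose2[OF indep_centered]) measurable
  hence dn: "(\<integral>\<^sup>+ \<omega>. ennreal (exp (l * (\<Sum>i=1..N. - centered t i \<omega>))) \<partial>M) \<le> ennreal (exp (real (card {1..N}) * l\<^sup>2 / 8))"
  proof (rule mgf_indep_sum_le[OF finite_atLeastAtMost, where a = "?m - 1"])
    show "expectation (\<lambda>\<omega>. - centered t i \<omega>) = 0" if "i \<in> {1..N}" for i
      using expectation_centered(1)[OF that] by simp
  qed (auto simp: l centered_def indicator_def)
  have "(\<integral>\<^sup>+ \<omega>. ennreal (exp (\<kappa> * sqrt (real N) * cdf_error t \<omega>)) \<partial>M)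
        \<le> (\<integral>\<^sup>+ \<omega>. ennreal (exp (l * ?S \<omega>)) + ennreal (exp (l * (\<Sum>i=1..N. - centered t i \<omega>))) \<partial>M)"
  proof (rule nn_integral_mono)
    fix \<omega>
    have "\<kappa> * sqrt (real N) * cdf_error t \<omega> = l * \<bar>?S \<omega>\<bar>"
      using N_pos by (simp add: cdf_error_centered l_def field_simps)
    moreover have "exp (l * \<bar>?S \<omega>\<bar>) \<le> exp (l * ?S \<omega>) + exp (l * - ?S \<omega>)"
      by (cases "?S \<omega> \<ge> 0") (auto simp: add_increasing add_increasing2)
    ultimately have "exp (\<kappa> * sqrt (real N) * cdf_error t \<omega>) \<le> exp (l * ?S \<omega>) + exp (l * (\<Sum>i=1..N. - centered t i \<omega>))"
      by (simp add: sum_negf)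
    thus "ennreal (exp (\<kappa> * sqrt (real N) * cdf_error t \<omega>))
        \<le> ennreal (exp (l * ?S \<omega>)) + ennreal (exp (l * (\<Sum>i=1..N. - centered t i \<omega>)))"
      by (simp add: ennreal_leI flip: ennreal_plus)
  qed
  also have "\<dots> = (\<integral>\<^sup>+ \<omega>. ennreal (exp (l * ?S \<omega>)) \<partial>M) + (\<integral>\<^sup>+ \<omega>. ennreal (exp (l * (\<Sum>i=1..N. - centered t i \<omega>))) \<partial>M)"
    by (rule nn_integral_add) (auto simp: sum_negf)
  also have "\<dots> \<le> ennreal (exp (real (card {1..N}) * l\<^sup>2 / 8)) + ennreal (exp (real (card {1..N}) * l\<^sup>2 / 8))"
    using up dn by (rule add_mono)
  also have "\<dots> = ennreal (2 * exp (\<kappa>\<^sup>2 / 8))"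
    using l2 by (simp flip: ennreal_plus)
  finally show ?thesis .
qed

lemma cdf_error_measurable [measurable]:
  "(\<lambda>(t, \<omega>). cdf_error t \<omega>) \<in> borel_measurable (lborel \<Otimes>\<^sub>M M)"
proof -
  interpret F: prob_space F by (rule prob_space_F)
  have [measurable]: "(\<lambda>t. measure F {..t}) \<in> borel_measurable borel"
    by (intro borel_measurable_mono monoI F.finite_measure_mono) auto
  have "(\<lambda>w. \<Sum>i=1..N. indicator {..fst w} (e i (snd w)) :: real) \<in> borel_measurable (lborel \<Otimes>\<^sub>M M)"
  proof (rule borel_measurable_sum)
    fix i assume i: "i \<in> {1..N}"
    note [measurable] = rv_e[OF i]
    have "(\<lambda>w. indicator {..fst w} (e i (snd w)) :: real) = (\<lambda>w. if e i (snd w) \<le> fst w then 1 else 0)"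
      by (auto simp: fun_eq_iff)
    thus "(\<lambda>w. indicator {..fst w} (e i (snd w)) :: real) \<in> borel_measurable (lborel \<Otimes>\<^sub>M M)"
      by simp
  qed
  thus ?thesis unfolding cdf_error_def case_prod_beta' by measurable
qed

end

section \<open>The integrated error of the empirical distribution function\<close>

context iid_sample
begin

lemma pair_sigma_finite_lborel: "pair_sigma_finite lborel M"
  unfolding pair_sigma_finite_def
  using lborel.sigma_finite_measure_axioms sigma_finite_measure_axioms by blast

lemma cdf_error_nonneg: "0 \<le> cdf_error t \<omega>"
  by (simp add: cdf_error_def)

text \<open>Since \<open>exp\<close> is convex, an exponential moment bound that holds for each \<open>t\<close> passes to the average
  over \<open>t\<close> in \<open>[-1, 1]\<close>.  Markov's inequality controls the integral
  \<open>Z\<close> of \<open>exp (\<kappa> * sqrt N * cdf_error t)\<close>, and the tangent of \<open>exp\<close> at \<open>2 * ln (2 / \<delta>)\<close> turns the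
  bound on \<open>Z\<close> into one on the integral of the error itself.\<close>

lemma cdf_error_core_le:
  assumes \<delta>: "0 < \<delta>" "\<delta> \<le> 1 / 2"
  obtains A where "A \<in> events" "prob A \<le> \<delta>"
    "\<And>\<omega>. \<omega> \<in> space M - A \<Longrightarrow> (\<integral>\<^sup>+ t. ennreal (cdf_error t \<omega>) * indicator {-1..1} t \<partial>lborel)
        \<le> ennreal (sqrt (2 * ln (2 / \<delta>)) / sqrt (real N))"
proof -
  interpret P: pair_sigma_finite lborel M by (rule pair_sigma_finite_lborel)
  define k where "k = ln (2 / \<delta>)"
  have "exp 1 \<le> (4 :: real)" using exp_le by simp
  also have "4 \<le> 2 / \<delta>" using \<delta> by (simp add: field_simps)
  finally have k: "k \<ge> 1" unfolding k_def using \<delta> by (subst ln_ge_iff) auto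
  \<comment> \<open>This choice balances the two terms of the resulting bound \<open>\<kappa> / 4 + 2 * k / \<kappa>\<close>.\<close>
  define \<kappa> where "\<kappa> = sqrt (8 * k)"
  have \<kappa>: "\<kappa> > 0" "\<kappa>\<^sup>2 = 8 * k" using k by (auto simp: \<kappa>_def)
  let ?J = "{-1..1} :: real set"
  let ?E = "\<lambda>t \<omega>. exp (\<kappa> * sqrt (real N) * cdf_error t \<omega>)"
  define Z where "Z = (\<lambda>\<omega>. \<integral>\<^sup>+ t. ennreal (?E t \<omega>) * indicator ?J t \<partial>lborel)"
  have E_meas: "(\<lambda>(t, \<omega>). ennreal (?E t \<omega>) * indicator ?J t) \<in> borel_measurable (lborel \<Otimes>\<^sub>M M)"
    using cdf_error_measurable unfolding case_prod_beta' by measurable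
  have Z_meas: "Z \<in> borel_measurable M"
    unfolding Z_def using measurable_pair_swap[OF E_meas]
    by (intro lborel.borel_measurable_nn_integral) (simp only: prod.case)
  have "(\<integral>\<^sup>+ \<omega>. Z \<omega> \<partial>M) = (\<integral>\<^sup>+ t. (\<integral>\<^sup>+ \<omega>. ennreal (?E t \<omega>) * indicator ?J t \<partial>M) \<partial>lborel)"
    unfolding Z_def using E_meas by (rule P.Fubini')
  also have "\<dots> = (\<integral>\<^sup>+ t. (\<integral>\<^sup>+ \<omega>. ennreal (?E t \<omega>) \<partial>M) * indicator ?J t \<partial>lborel)"
    by (intro nn_integral_cong) (auto simp: indicator_def)
  also have "\<dots> \<le> (\<integral>\<^sup>+ t. ennreal (2 * exp k) * indicator ?J t \<partial>lborel)"
    using cdf_error_mgf[OF \<kappa>(1)] \<kappa>(2) by (intro nn_integral_mono mult_right_mono) auto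
  also have "\<dots> = ennreal (4 * exp k)"
    by (simp add: nn_integral_cmult_indicator flip: ennreal_mult ennreal_numeral)
  also have "\<dots> = ennreal (\<delta> * (2 * exp (2 * k)))"
  proof -
    have "exp k = 2 / \<delta>" using \<delta> by (simp add: k_def)
    hence "4 * exp k = \<delta> * (2 * (exp k * exp k))" using \<delta> by (simp add: field_simps)
    also have "exp k * exp k = exp (2 * k)" by (simp flip: exp_add)
    finally show ?thesis by (rule arg_cong)
  qed
  finally obtain A where A: "A \<in> events" "prob A \<le> \<delta>"
      "\<And>\<omega>. \<omega> \<in> space M - A \<Longrightarrow> Z \<omega> \<le> ennreal (2 * exp (2 * k))"
    using \<delta> by (elim Markov_exceptional_event[OF Z_meas, rotated -1]) auto
  have "(\<integral>\<^sup>+ t. ennreal (cdf_error t \<omega>) * indicator ?J t \<partial>lborel)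
        \<le> ennreal (sqrt (2 * ln (2 / \<delta>)) / sqrt (real N))" if \<omega>: "\<omega> \<in> space M - A" for \<omega>
  proof -
    have D_meas [measurable]: "(\<lambda>t. cdf_error t \<omega>) \<in> borel_measurable borel"
      using measurable_Pair1[OF cdf_error_measurable, of \<omega>] \<omega> by (simp add: measurable_lborel2)
    let ?c = "\<kappa> * sqrt (real N)"
    have c: "?c > 0" using \<kappa> N_pos by simp
    have "(\<integral>\<^sup>+ t. ennreal (?c * cdf_error t \<omega>) * indicator ?J t \<partial>lborel)
        \<le> (\<integral>\<^sup>+ t. ennreal (2 * k - 1) * indicator ?J t + ennreal (exp (- (2 * k))) * (ennreal (?E t \<omega>) * indicator ?J t) \<partial>lborel)"
    proof (rule nn_integral_mono)
      fix t
      have "1 + (?c * cdf_error t \<omega> - 2 * k) \<le> exp (?c * cdf_error t \<omega> - 2 * k)"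
        by (rule exp_ge_add_one_self)
      moreover have "exp (?c * cdf_error t \<omega> - 2 * k) = exp (- (2 * k)) * ?E t \<omega>"
        by (simp add: mult_exp_exp)
      ultimately have "?c * cdf_error t \<omega> \<le> (2 * k - 1) + exp (- (2 * k)) * ?E t \<omega>"
        by linarith
      hence "ennreal (?c * cdf_error t \<omega>) \<le> ennreal ((2 * k - 1) + exp (- (2 * k)) * ?E t \<omega>)"
        by (rule ennreal_leI)
      also have "\<dots> = ennreal (2 * k - 1) + ennreal (exp (- (2 * k))) * ennreal (?E t \<omega>)"
        using k by (simp add: ennreal_plus ennreal_mult)
      finally show "ennreal (?c * cdf_error t \<omega>) * indicator ?J t
          \<le> ennreal (2 * k - 1) * indicator ?J t + ennreal (exp (- (2 * k))) * (ennreal (?E t \<omega>) * indicator ?J t)"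
        by (auto simp: indicator_def)
    qed
    also have "\<dots> = ennreal (2 * k - 1) * 2 + ennreal (exp (- (2 * k))) * Z \<omega>"
      unfolding Z_def by (subst nn_integral_add) (auto simp: nn_integral_cmult nn_integral_cmult_indicator)
    also have "\<dots> \<le> ennreal (2 * k - 1) * 2 + ennreal (exp (- (2 * k))) * ennreal (2 * exp (2 * k))"
      using A(3)[OF \<omega>] by (intro add_left_mono mult_left_mono) auto
    also have "ennreal (exp (- (2 * k))) * ennreal (2 * exp (2 * k)) = ennreal 2"
    proof -
      have "exp (- (2 * k)) * (2 * exp (2 * k)) = 2" by (simp add: exp_minus field_simps)
      thus ?thesis by (metis ennreal_mult' exp_ge_zero)
    qed
    also have "ennreal (2 * k - 1) * 2 = ennreal ((2 * k - 1) * 2)"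
      using k ennreal_mult'[of "2 * k - 1" 2] by simp
    also have "ennreal ((2 * k - 1) * 2) + ennreal 2 = ennreal ((2 * k - 1) * 2 + 2)"
      using k by (intro ennreal_plus[symmetric]) auto
    finally have le: "(\<integral>\<^sup>+ t. ennreal (?c * cdf_error t \<omega>) * indicator ?J t \<partial>lborel) \<le> ennreal (4 * k)"
      by simp
    have "(\<integral>\<^sup>+ t. ennreal (cdf_error t \<omega>) * indicator ?J t \<partial>lborel)
        = (\<integral>\<^sup>+ t. ennreal (1 / ?c) * (ennreal (?c * cdf_error t \<omega>) * indicator ?J t) \<partial>lborel)"
    proof (rule nn_integral_cong)
      fix t
      have "ennreal (cdf_error t \<omega>) = ennreal (1 / ?c * (?c * cdf_error t \<omega>))"
        using \<kappa>(1) N_pos by (intro arg_cong[where f = ennreal]) simp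
      also have "\<dots> = ennreal (1 / ?c) * ennreal (?c * cdf_error t \<omega>)"
        using c by (intro ennreal_mult') simp
      finally show "ennreal (cdf_error t \<omega>) * indicator ?J t
          = ennreal (1 / ?c) * (ennreal (?c * cdf_error t \<omega>) * indicator ?J t)"
        by (simp only: mult.assoc)
    qed
    also have "\<dots> = ennreal (1 / ?c) * (\<integral>\<^sup>+ t. ennreal (?c * cdf_error t \<omega>) * indicator ?J t \<partial>lborel)"
      by (rule nn_integral_cmult) measurable
    also have "\<dots> \<le> ennreal (1 / ?c) * ennreal (4 * k)"
      using le by (rule mult_left_mono) simp
    also have "\<dots> = ennreal (4 * k / \<kappa> / sqrt (real N))"
      using c k by (simp flip: ennreal_mult)
    also have "4 * k / \<kappa> = sqrt (2 * k)"
    proof -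
      have "\<kappa> * sqrt (2 * k) = sqrt (16 * k\<^sup>2)"
        unfolding \<kappa>_def by (simp add: power2_eq_square flip: real_sqrt_mult)
      also have "\<dots> = 4 * k" using k by (simp add: real_sqrt_mult)
      finally show ?thesis using \<kappa> by (simp add: field_simps)
    qed
    finally show ?thesis unfolding k_def .
  qed
  with A(1,2) show ?thesis by (rule that)
qed

lemma tail_weight_integral:
  assumes r: "r > 2"
  shows "(\<integral>\<^sup>+ t. ennreal (\<bar>t\<bar> powr (- r / 2)) * indicator (- {-1..1}) t \<partial>lborel) \<le> ennreal (4 / (r - 2))"
proof -
  let ?f = "\<lambda>t :: real. t powr (- r / 2)"
  define G where "G = (\<lambda>t :: real. t powr (1 - r / 2) / (1 - r / 2))"
  have half: "(\<integral>\<^sup>+ t. ennreal (?f t) * indicator {1..} t \<partial>lborel) = ennreal (0 - G 1)"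
  proof (rule nn_integral_FTC_atLeast)
    show "DERIV G t :> ?f t" if "1 \<le> t" for t
      unfolding G_def using that r by (auto intro!: derivative_eq_intros)
    have "((\<lambda>t. t powr (1 - r / 2)) \<longlongrightarrow> 0) at_top"
      using r by (intro tendsto_neg_powr filterlim_ident) auto
    thus "(G \<longlongrightarrow> 0) at_top" unfolding G_def by (rule tendsto_divide_zero)
  qed auto
  have G1: "0 - G 1 = 2 / (r - 2)" using r by (simp add: G_def field_simps)
  have neg: "(\<integral>\<^sup>+ t. ennreal (?f (- t)) * indicator {1..} (- t) \<partial>lborel) = ennreal (2 / (r - 2))"
    using nn_integral_real_affine[of "\<lambda>t. ennreal (?f t) * indicator {1..} t" "-1" 0] half G1 by simp
  have "(\<integral>\<^sup>+ t. ennreal (\<bar>t\<bar> powr (- r / 2)) * indicator (- {-1..1}) t \<partial>lborel)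
     \<le> (\<integral>\<^sup>+ t. ennreal (?f t) * indicator {1..} t + ennreal (?f (- t)) * indicator {1..} (- t) \<partial>lborel)"
    by (intro nn_integral_mono) (auto simp: indicator_def)
  also have "\<dots> = (\<integral>\<^sup>+ t. ennreal (?f t) * indicator {1..} t \<partial>lborel)
      + (\<integral>\<^sup>+ t. ennreal (?f (- t)) * indicator {1..} (- t) \<partial>lborel)"
    by (rule nn_integral_add) measurable
  also have "\<dots> = ennreal (0 - G 1) + ennreal (2 / (r - 2))"
    unfolding half neg ..
  also have "\<dots> = ennreal (4 / (r - 2))" unfolding G1 using r by (simp flip: ennreal_plus)
  finally show ?thesis .
qed

text \<open>One of the factors \<open>F t\<close> and \<open>1 - F t\<close> is a tail probability beyond \<open>\<bar>t\<bar>\<close>, to which Markov's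
  inequality for the \<open>r\<close>-th moment applies.\<close>

lemma cdf_variance_le_moment:
  assumes int: "integrable F (\<lambda>u. \<bar>u\<bar> powr r)" and t: "t \<noteq> 0" and r: "r > 0"
  shows "measure F {..t} * (1 - measure F {..t}) \<le> (\<integral>u. \<bar>u\<bar> powr r \<partial>F) * \<bar>t\<bar> powr (- r)"
proof -
  interpret F: prob_space F by (rule prob_space_F)
  have M: "F.prob {u \<in> space F. \<bar>u\<bar> powr r \<ge> \<bar>t\<bar> powr r} \<le> (\<integral>u. \<bar>u\<bar> powr r \<partial>F) / \<bar>t\<bar> powr r"
    using t by (intro integral_Markov_inequality_measure[OF int, of "{}"]) auto
  hence tail: "F.prob {u. \<bar>t\<bar> \<le> \<bar>u\<bar>} \<le> (\<integral>u. \<bar>u\<bar> powr r \<partial>F) * \<bar>t\<bar> powr (- r)"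
  proof -
    have "\<bar>t\<bar> powr r \<le> \<bar>u\<bar> powr r \<longleftrightarrow> \<bar>t\<bar> \<le> \<bar>u\<bar>" for u :: real
      using powr_mono2[of r "\<bar>t\<bar>" "\<bar>u\<bar>"] powr_less_mono2[of r "\<bar>u\<bar>" "\<bar>t\<bar>"] r by force
    with M show ?thesis by (simp add: powr_minus_divide)
  qed
  have m: "{u :: real. \<bar>t\<bar> \<le> \<bar>u\<bar>} \<in> sets F" by simp
  have "measure F {..t} * (1 - measure F {..t}) \<le> F.prob {u. \<bar>t\<bar> \<le> \<bar>u\<bar>}"
  proof (cases "t < 0")
    case True
    have "measure F {..t} * (1 - measure F {..t}) \<le> measure F {..t}"
      using F.prob_le_1 by (intro mult_left_le) auto
    also have "\<dots> \<le> F.prob {u. \<bar>t\<bar> \<le> \<bar>u\<bar>}"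
      using True m by (intro F.finite_measure_mono) auto
    finally show ?thesis .
  next
    case False
    have "measure F {..t} * (1 - measure F {..t}) \<le> 1 - measure F {..t}"
      using F.prob_le_1 by (intro mult_left_le_one_le) auto
    also have "\<dots> = F.prob (space F - {..t})" by (rule F.prob_compl[symmetric]) simp
    also have "\<dots> \<le> F.prob {u. \<bar>t\<bar> \<le> \<bar>u\<bar>}"
      using False m by (intro F.finite_measure_mono) auto
    finally show ?thesis .
  qed
  thus ?thesis using tail by (rule order_trans)
qed

text \<open>Cauchy-Schwarz with the weight \<open>\<bar>t\<bar> powr (- r / 2)\<close> bounds the square of the integrated error by the
  integral of the weight, \<open>4 / (r - 2)\<close>, times the integral \<open>Y\<close> of the squared error divided by the
  weight.  The squared error has expectation of order \<open>\<bar>t\<bar> powr (- r)\<close>, so the expectation of \<open>Y\<close>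
  is again a multiple of the integral of the weight.\<close>

lemma cdf_error_tail_le:
  assumes \<delta>: "0 < \<delta>" and r: "r > 2" and int: "integrable F (\<lambda>u. \<bar>u\<bar> powr r)"
    and \<Gamma>: "\<Gamma> = (\<integral>u. \<bar>u\<bar> powr r \<partial>F)"
  obtains A where "A \<in> events" "prob A \<le> \<delta>"
    "\<And>\<omega>. \<omega> \<in> space M - A \<Longrightarrow> (\<integral>\<^sup>+ t. ennreal (cdf_error t \<omega>) * indicator (- {-1..1}) t \<partial>lborel)
        \<le> ennreal (4 / (r - 2) * sqrt (\<Gamma> / \<delta>) / sqrt (real N))"
proof -
  interpret P: pair_sigma_finite lborel M by (rule pair_sigma_finite_lborel)
  have \<Gamma>0: "\<Gamma> \<ge> 0" unfolding \<Gamma> by (rule integral_nonneg_AE) simp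
  let ?J = "- {-1..1} :: real set"
  define I where "I = 4 / (r - 2)"
  have I: "I > 0" using r by (simp add: I_def)
  define Y where "Y = (\<lambda>\<omega>. \<integral>\<^sup>+ t. ennreal ((cdf_error t \<omega>)\<^sup>2 * \<bar>t\<bar> powr (r / 2)) * indicator ?J t \<partial>lborel)"
  have E_meas: "(\<lambda>(t, \<omega>). ennreal ((cdf_error t \<omega>)\<^sup>2 * \<bar>t\<bar> powr (r / 2)) * indicator ?J t) \<in> borel_measurable (lborel \<Otimes>\<^sub>M M)"
    using cdf_error_measurable unfolding case_prod_beta' by measurable
  have Y_meas: "Y \<in> borel_measurable M"
    unfolding Y_def using measurable_pair_swap[OF E_meas]
    by (intro lborel.borel_measurable_nn_integral) (simp only: prod.case)
  have Dt [measurable]: "(\<lambda>\<omega>. cdf_error t \<omega>) \<in> borel_measurable M" for t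
    using measurable_Pair2[OF cdf_error_measurable, of t] by simp
  have "(\<integral>\<^sup>+ \<omega>. Y \<omega> \<partial>M) = (\<integral>\<^sup>+ t. (\<integral>\<^sup>+ \<omega>. ennreal ((cdf_error t \<omega>)\<^sup>2 * \<bar>t\<bar> powr (r / 2)) * indicator ?J t \<partial>M) \<partial>lborel)"
    unfolding Y_def using E_meas by (rule P.Fubini')
  also have "\<dots> \<le> (\<integral>\<^sup>+ t. ennreal (\<Gamma> / real N) * (ennreal (\<bar>t\<bar> powr (- r / 2)) * indicator ?J t) \<partial>lborel)"
  proof (rule nn_integral_mono)
    fix t :: real
    show "(\<integral>\<^sup>+ \<omega>. ennreal ((cdf_error t \<omega>)\<^sup>2 * \<bar>t\<bar> powr (r / 2)) * indicator ?J t \<partial>M)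
        \<le> ennreal (\<Gamma> / real N) * (ennreal (\<bar>t\<bar> powr (- r / 2)) * indicator ?J t)"
    proof (cases "t \<in> ?J")
      case True
      hence t: "t \<noteq> 0" by auto
      have "(\<integral>\<^sup>+ \<omega>. ennreal ((cdf_error t \<omega>)\<^sup>2 * \<bar>t\<bar> powr (r / 2)) * indicator ?J t \<partial>M)
          = (\<integral>\<^sup>+ \<omega>. ennreal ((cdf_error t \<omega>)\<^sup>2) * ennreal (\<bar>t\<bar> powr (r / 2)) \<partial>M)"
        using True by (simp add: ennreal_mult)
      also have "\<dots> = ennreal (measure F {..t} * (1 - measure F {..t}) / real N) * ennreal (\<bar>t\<bar> powr (r / 2))"
        by (subst nn_integral_multc) (auto simp: cdf_error_second_moment)
      also have "\<dots> \<le> ennreal (\<Gamma> * \<bar>t\<bar> powr (- r) / real N) * ennreal (\<bar>t\<bar> powr (r / 2))"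
        using cdf_variance_le_moment[OF int t] r unfolding \<Gamma>
        by (intro mult_right_mono ennreal_leI divide_right_mono) auto
      also have "\<dots> = ennreal (\<Gamma> / real N * (\<bar>t\<bar> powr (- r) * \<bar>t\<bar> powr (r / 2)))"
        using \<Gamma>0 by (simp flip: ennreal_mult)
      also have "\<bar>t\<bar> powr (- r) * \<bar>t\<bar> powr (r / 2) = \<bar>t\<bar> powr (- r / 2)"
        by (simp flip: powr_add)
      also have "ennreal (\<Gamma> / real N * \<bar>t\<bar> powr (- r / 2)) = ennreal (\<Gamma> / real N) * ennreal (\<bar>t\<bar> powr (- r / 2))"
        using \<Gamma>0 by (intro ennreal_mult) auto
      finally show ?thesis using True by simp
    qed auto
  qed
  also have "\<dots> = ennreal (\<Gamma> / real N) * (\<integral>\<^sup>+ t. ennreal (\<bar>t\<bar> powr (- r / 2)) * indicator ?J t \<partial>lborel)"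
    by (rule nn_integral_cmult) measurable
  also have "\<dots> \<le> ennreal (\<Gamma> / real N) * ennreal I"
    unfolding I_def by (intro mult_left_mono tail_weight_integral r) auto
  also have "\<dots> = ennreal (\<delta> * (\<Gamma> * I / (\<delta> * real N)))"
    using \<Gamma>0 I \<delta> by (simp flip: ennreal_mult)
  finally obtain A where A: "A \<in> events" "prob A \<le> \<delta>"
      "\<And>\<omega>. \<omega> \<in> space M - A \<Longrightarrow> Y \<omega> \<le> ennreal (\<Gamma> * I / (\<delta> * real N))"
    using \<delta> \<Gamma>0 I by (elim Markov_exceptional_event[OF Y_meas, rotated -1]) auto
  have "(\<integral>\<^sup>+ t. ennreal (cdf_error t \<omega>) * indicator ?J t \<partial>lborel)
        \<le> ennreal (4 / (r - 2) * sqrt (\<Gamma> / \<delta>) / sqrt (real N))" if \<omega>: "\<omega> \<in> space M - A" for \<omega>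
  proof -
    have D_meas [measurable]: "(\<lambda>t. cdf_error t \<omega>) \<in> borel_measurable borel"
      using measurable_Pair1[OF cdf_error_measurable, of \<omega>] \<omega> by (simp add: measurable_lborel2)
    let ?T = "\<integral>\<^sup>+ t. ennreal (cdf_error t \<omega>) * indicator ?J t \<partial>lborel"
    let ?u = "\<lambda>t :: real. ennreal (\<bar>t\<bar> powr (- r / 4)) * indicator ?J t"
    let ?v = "\<lambda>t. ennreal (cdf_error t \<omega> * \<bar>t\<bar> powr (r / 4)) * indicator ?J t"
    have "?T = (\<integral>\<^sup>+ t. ?u t * ?v t \<partial>lborel)"
    proof (rule nn_integral_cong)
      fix t :: real
      show "ennreal (cdf_error t \<omega>) * indicator ?J t = ?u t * ?v t"
      proof (cases "t \<in> ?J")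
        case True
        hence "\<bar>t\<bar> powr (- r / 4) * \<bar>t\<bar> powr (r / 4) = 1" by (auto simp flip: powr_add)
        hence "cdf_error t \<omega> = \<bar>t\<bar> powr (- r / 4) * (cdf_error t \<omega> * \<bar>t\<bar> powr (r / 4))" by algebra
        thus ?thesis using True cdf_error_nonneg[of t \<omega>] by (simp flip: ennreal_mult)
      qed auto
    qed
    hence "?T\<^sup>2 = (\<integral>\<^sup>+ t. ?u t * ?v t \<partial>lborel)\<^sup>2" by simp
    also have "\<dots> \<le> (\<integral>\<^sup>+ t. (?u t)\<^sup>2 \<partial>lborel) * (\<integral>\<^sup>+ t. (?v t)\<^sup>2 \<partial>lborel)"
      by (rule Cauchy_Schwarz_nn_integral) measurable
    also have "(\<integral>\<^sup>+ t. (?u t)\<^sup>2 \<partial>lborel) = (\<integral>\<^sup>+ t. ennreal (\<bar>t\<bar> powr (- r / 2)) * indicator ?J t \<partial>lborel)"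
      by (intro nn_integral_cong) (auto simp: indicator_def power2_eq_square simp flip: ennreal_mult powr_add)
    also have "(\<integral>\<^sup>+ t. (?v t)\<^sup>2 \<partial>lborel) = Y \<omega>"
      unfolding Y_def using cdf_error_nonneg
      by (intro nn_integral_cong)
         (auto simp: indicator_def power2_eq_square mult_ac simp flip: ennreal_mult powr_add)
    also have "(\<integral>\<^sup>+ t. ennreal (\<bar>t\<bar> powr (- r / 2)) * indicator ?J t \<partial>lborel) * Y \<omega>
        \<le> ennreal I * ennreal (\<Gamma> * I / (\<delta> * real N))"
      using A(3)[OF \<omega>] tail_weight_integral[OF r] unfolding I_def by (intro mult_mono) auto
    also have "\<dots> = ennreal ((I * sqrt (\<Gamma> / \<delta>) / sqrt (real N))\<^sup>2)"
      using I \<Gamma>0 \<delta> N_pos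
      by (simp add: power_divide power_mult_distrib power2_eq_square field_simps flip: ennreal_mult)
    finally have sq: "?T\<^sup>2 \<le> ennreal ((I * sqrt (\<Gamma> / \<delta>) / sqrt (real N))\<^sup>2)" .
    show ?thesis
    proof (cases ?T)
      case (real x)
      have "x\<^sup>2 \<le> (I * sqrt (\<Gamma> / \<delta>) / sqrt (real N))\<^sup>2"
        using sq real by (simp add: ennreal_power)
      hence "x \<le> I * sqrt (\<Gamma> / \<delta>) / sqrt (real N)"
        using I \<Gamma>0 \<delta> by (rule_tac power2_le_imp_le) auto
      thus ?thesis using real by (simp add: I_def ennreal_leI)
    next
      case top
      thus ?thesis using sq by (simp add: top_unique)
    qed
  qed
  with A(1,2) show ?thesis by (rule that)
qed

end

section \<open>Least squares\<close>

text \<open>Writing the Gram matrix through inner products with the rows keeps the later arguments free of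
  coordinates.\<close>

lemma gram_mult_vec: "gram x N *v v = (\<Sum>i=1..N. (x i \<bullet> v) *\<^sub>R x i)"
proof (rule vec_eq_iff[THEN iffD2], rule allI)
  fix j
  have "(gram x N *v v) $ j = (\<Sum>k\<in>UNIV. \<Sum>i=1..N. x i $ j * x i $ k * v $ k)"
    by (simp add: matrix_vector_mult_def gram_def sum_distrib_right)
  also have "\<dots> = (\<Sum>i=1..N. \<Sum>k\<in>UNIV. x i $ j * x i $ k * v $ k)" by (rule sum.swap)
  also have "\<dots> = (\<Sum>i=1..N. (x i \<bullet> v) *\<^sub>R x i) $ j"
    by (simp add: inner_vec_def sum_distrib_left sum_distrib_right mult_ac)
  finally show "(gram x N *v v) $ j = (\<Sum>i=1..N. (x i \<bullet> v) *\<^sub>R x i) $ j" .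
qed

lemma inner_gram: "u \<bullet> (gram x N *v v) = (\<Sum>i=1..N. (x i \<bullet> u) * (x i \<bullet> v))"
  unfolding gram_mult_vec by (simp add: inner_sum_right inner_commute mult.commute)

lemma invertible_gram:
  fixes x :: "nat \<Rightarrow> real ^ 'd"
  assumes full: "dim (x ` {1..N}) = CARD('d)"
  shows "invertible (gram x N)"
  unfolding invertible_left_inverse matrix_left_invertible_ker
proof (intro allI impI)
  fix v assume "gram x N *v v = 0"
  hence "(\<Sum>i=1..N. (x i \<bullet> v) * (x i \<bullet> v)) = 0" using inner_gram[of v x N v] by simp
  hence "x i \<bullet> v = 0" if "i \<in> {1..N}" for i
    using that by (subst (asm) sum_nonneg_eq_0_iff) auto
  hence "orthogonal v u" if "u \<in> x ` {1..N}" for u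
    using that by (auto simp: orthogonal_def inner_commute)
  moreover have "v \<in> span (x ` {1..N})"
    using full dim_eq_full[of "x ` {1..N}"] by simp
  ultimately have "orthogonal v v"
    by (metis orthogonal_to_span)
  thus "v = 0" by (simp add: orthogonal_self)
qed

lemma matrix_inv_mult:
  assumes "invertible A"
  shows "A ** matrix_inv A = mat 1" "matrix_inv A ** A = mat 1"
  using someI_ex[OF assms[unfolded invertible_def]] by (auto simp: matrix_inv_def)

lemma inner_matrix_inv_gram:
  assumes inv: "invertible (gram x N)"
  shows "(matrix_inv (gram x N) *v u) \<bullet> v = u \<bullet> (matrix_inv (gram x N) *v v)"
proof -
  define a b where "a = matrix_inv (gram x N) *v u" and "b = matrix_inv (gram x N) *v v"
  have "gram x N *v a = u" "gram x N *v b = v"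
    using matrix_inv_mult(1)[OF inv] by (simp_all add: a_def b_def matrix_vector_mul_assoc)
  hence "a \<bullet> v = b \<bullet> u"
    using inner_gram[of a x N b] inner_gram[of b x N a] by (simp add: mult.commute)
  thus ?thesis by (simp add: a_def b_def inner_commute)
qed

lemma ols_error:
  assumes inv: "invertible (gram x N)" and y: "\<And>i. i \<in> {1..N} \<Longrightarrow> y i = \<beta> \<bullet> x i + e i"
  shows "(ols x y N - \<beta>) \<bullet> v = (\<Sum>i=1..N. (x i \<bullet> (matrix_inv (gram x N) *v v)) * e i)"
proof -
  let ?H = "matrix_inv (gram x N)"
  have "(\<Sum>i=1..N. y i *\<^sub>R x i) = (\<Sum>i=1..N. (x i \<bullet> \<beta>) *\<^sub>R x i + e i *\<^sub>R x i)"
    by (intro sum.cong) (auto simp: y scaleR_add_left inner_commute)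
  also have "\<dots> = gram x N *v \<beta> + (\<Sum>i=1..N. e i *\<^sub>R x i)"
    by (simp add: sum.distrib gram_mult_vec)
  finally have "ols x y N = ?H *v (gram x N *v \<beta>) + ?H *v (\<Sum>i=1..N. e i *\<^sub>R x i)"
    by (simp add: ols_def matrix_vector_right_distrib)
  also have "?H *v (gram x N *v \<beta>) = \<beta>"
    using matrix_inv_mult(2)[OF inv] by (simp add: matrix_vector_mul_assoc)
  finally have "(ols x y N - \<beta>) \<bullet> v = (\<Sum>i=1..N. e i *\<^sub>R x i) \<bullet> (?H *v v)"
    by (simp add: inner_matrix_inv_gram[OF inv])
  thus ?thesis by (simp add: inner_sum_left mult.commute)
qed

lemma ols_weights_norm:
  assumes inv: "invertible (gram x N)"
  shows "(\<Sum>i=1..N. (x i \<bullet> (matrix_inv (gram x N) *v v))\<^sup>2) = v \<bullet> (matrix_inv (gram x N) *v v)"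
proof -
  let ?w = "matrix_inv (gram x N) *v v"
  have "(\<Sum>i=1..N. (x i \<bullet> ?w)\<^sup>2) = ?w \<bullet> (gram x N *v ?w)"
    by (simp add: inner_gram power2_eq_square)
  also have "gram x N *v ?w = v"
    using matrix_inv_mult(1)[OF inv] by (simp add: matrix_vector_mul_assoc)
  finally show ?thesis by (simp add: inner_commute)
qed

text \<open>The sum is the trace of the inverse Gram matrix times the Gram matrix, hence of the identity.\<close>

lemma ols_leverage_sum:
  fixes x :: "nat \<Rightarrow> real ^ 'd"
  assumes inv: "invertible (gram x N)"
  shows "(\<Sum>k=1..N. x k \<bullet> (matrix_inv (gram x N) *v x k)) = real CARD('d)"
proof -
  let ?H = "matrix_inv (gram x N)"
  have "(\<Sum>k=1..N. x k \<bullet> (?H *v x k)) = (\<Sum>k=1..N. \<Sum>j\<in>UNIV. \<Sum>l\<in>UNIV. ?H $ j $ l * (x k $ l * x k $ j))"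
    by (simp add: inner_vec_def matrix_vector_mult_def sum_distrib_left mult_ac)
  also have "\<dots> = (\<Sum>j\<in>UNIV. \<Sum>l\<in>UNIV. \<Sum>k=1..N. ?H $ j $ l * (x k $ l * x k $ j))"
    by (subst sum.swap) (intro sum.cong refl sum.swap)
  also have "\<dots> = (\<Sum>j\<in>UNIV. (?H ** gram x N) $ j $ j)"
    by (simp add: matrix_matrix_mult_def gram_def sum_distrib_left)
  also have "\<dots> = real CARD('d)"
    unfolding matrix_inv_mult(2)[OF inv] by (simp add: mat_def)
  finally show ?thesis .
qed

text \<open>The limit \<open>Q\<close> is bounded below by some \<open>B > 0\<close>, so the matrices \<open>(1 / N) * gram x N\<close> are eventually
  bounded below by \<open>B / 2\<close>; thus they are invertible and the quadratic form of the inverse Gram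
  matrix at \<open>c\<close> is at most \<open>2 * (norm c)\<^sup>2 / (B * N)\<close>.\<close>

lemma eps3_bigo:
  fixes x :: "nat \<Rightarrow> real ^ 'd"
  assumes lim: "(\<lambda>N. (1 / real N) *\<^sub>R gram x N) \<longlonglongrightarrow> Q" and Q: "invertible Q" and \<eta>: "0 < \<eta>"
  shows "(\<lambda>N. eps3 x c r \<Gamma> \<eta> N) \<in> O(\<lambda>N. 1 / sqrt (real N))"
proof -
  obtain B where B: "B > 0" "\<And>v. B * norm v \<le> norm (Q *v v)"
    using linear_inj_bounded_below_pos[OF matrix_vector_mul_linear inj_matrix_vector_mult[OF Q]] by auto
  \<comment> \<open>An upper bound for the operator norm of the difference to \<open>Q\<close>.\<close>
  define R where "R = (\<lambda>N. \<Sum>i\<in>UNIV. \<Sum>j\<in>UNIV. \<bar>((1 / real N) *\<^sub>R gram x N - Q) $ i $ j\<bar>)"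
  have "(\<lambda>N. ((1 / real N) *\<^sub>R gram x N) $ i $ j) \<longlonglongrightarrow> Q $ i $ j" for i j
    by (intro tendsto_vec_nth lim)
  hence "(\<lambda>N. \<bar>((1 / real N) *\<^sub>R gram x N - Q) $ i $ j\<bar>) \<longlonglongrightarrow> 0" for i j
    by (intro tendsto_rabs_zero) (simp add: LIM_zero)
  hence "R \<longlonglongrightarrow> 0" unfolding R_def by (intro tendsto_null_sum) auto
  hence ev: "\<forall>\<^sub>F N in sequentially. R N < B / 2"
    using order_tendstoD(2)[of R 0 sequentially "B / 2"] B(1) by simp
  define C where "C = \<bar>\<Gamma> powr (1 / r)\<bar> * sqrt (3 * (2 * (norm c)\<^sup>2 / B) / \<eta>)"
  have "\<forall>\<^sub>F N in sequentially. norm (eps3 x c r \<Gamma> \<eta> N) \<le> C * norm (1 / sqrt (real N))"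
    using ev eventually_ge_at_top[of 1]
  proof eventually_elim
    case (elim N)
    let ?A = "(1 / real N) *\<^sub>R gram x N"
    have low: "B / 2 * norm v \<le> norm (?A *v v)" for v
    proof -
      have "norm (Q *v v) \<le> norm (?A *v v) + norm ((?A - Q) *v v)"
        using norm_triangle_sub[of "Q *v v" "?A *v v"]
        by (simp add: matrix_vector_mult_diff_rdistrib norm_minus_commute)
      also have "norm ((?A - Q) *v v) \<le> onorm ((*v) (?A - Q)) * norm v"
        by (intro onorm matrix_vector_mul_bounded_linear)
      also have "\<dots> \<le> R N * norm v"
        unfolding R_def by (intro mult_right_mono onorm_le_matrix_component_sum) auto
      also have "\<dots> \<le> B / 2 * norm v" using elim by (intro mult_right_mono) auto
      finally show ?thesis using B(2)[of v] by simp
    qed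
    have "invertible (gram x N)"
      unfolding invertible_left_inverse matrix_left_invertible_ker
    proof (intro allI impI)
      fix v assume "gram x N *v v = 0"
      hence "?A *v v = 0" by (simp add: scaleR_matrix_vector_assoc[symmetric])
      hence "B / 2 * norm v \<le> 0" using low[of v] by simp
      thus "v = 0" using B(1) by (simp add: mult_le_0_iff)
    qed
    note inv = this
    define w where "w = matrix_inv (gram x N) *v c"
    have "gram x N *v w = c"
      using matrix_inv_mult(1)[OF inv] by (simp add: w_def matrix_vector_mul_assoc)
    hence "?A *v w = (1 / real N) *\<^sub>R c" by (simp add: scaleR_matrix_vector_assoc[symmetric])
    hence "B / 2 * norm w \<le> norm c / real N" using low[of w] by simp
    hence "norm w * B \<le> 2 * norm c / real N" by (simp add: mult.commute)
    hence "norm w \<le> 2 * norm c / real N / B" using B(1) by (simp only: pos_le_divide_eq)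
    hence w: "norm w \<le> 2 * norm c / B / real N" by (simp add: mult.commute)
    have cw0: "0 \<le> c \<bullet> w"
      unfolding w_def ols_weights_norm[OF inv, symmetric] by (intro sum_nonneg) auto
    have "c \<bullet> w \<le> norm c * norm w" by (rule norm_cauchy_schwarz)
    also have "\<dots> \<le> norm c * (2 * norm c / B / real N)" by (intro mult_left_mono w) auto
    finally have cw: "c \<bullet> w \<le> 2 * (norm c)\<^sup>2 / B / real N" by (simp add: power2_eq_square mult_ac)
    have "sqrt (3 * (c \<bullet> w) / \<eta>) \<le> sqrt (3 * (2 * (norm c)\<^sup>2 / B / real N) / \<eta>)"
      using cw \<eta> by (intro real_sqrt_le_mono divide_right_mono mult_left_mono) auto
    also have "\<dots> = sqrt (3 * (2 * (norm c)\<^sup>2 / B) / \<eta>) * (1 / sqrt (real N))"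
      by (simp add: real_sqrt_divide real_sqrt_mult)
    finally have "\<bar>\<Gamma> powr (1 / r)\<bar> * sqrt (3 * (c \<bullet> w) / \<eta>)
        \<le> \<bar>\<Gamma> powr (1 / r)\<bar> * (sqrt (3 * (2 * (norm c)\<^sup>2 / B) / \<eta>) * (1 / sqrt (real N)))"
      by (rule mult_left_mono) simp
    moreover have "norm (eps3 x c r \<Gamma> \<eta> N) = \<bar>\<Gamma> powr (1 / r)\<bar> * sqrt (3 * (c \<bullet> w) / \<eta>)"
      using cw0 \<eta> by (simp add: eps3_def abs_mult flip: w_def)
    ultimately show ?case by (simp add: C_def)
  qed
  thus ?thesis by (rule bigoI)
qed

text \<open>Lyapunov's inequality, by integrating Young's inequality
  \<open>t\<^sup>2 \<le> 2 / r * t powr r + (1 - 2 / r)\<close> at \<open>t = \<bar>u\<bar> / g\<close>, where \<open>g\<close> is the \<open>r\<close>-norm.\<close>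

lemma second_moment_le_moment:
  fixes F :: "real measure"
  assumes F: "prob_space F" "sets F = sets borel" and r: "r > 2"
    and int: "integrable F (\<lambda>u. \<bar>u\<bar> powr r)"
  shows "integrable F (\<lambda>u. u\<^sup>2)"
    and "(\<integral>u. u\<^sup>2 \<partial>F) \<le> ((\<integral>u. \<bar>u\<bar> powr r \<partial>F) powr (1 / r))\<^sup>2"
proof -
  interpret F: prob_space F by fact
  note [measurable_cong] = F(2)
  define \<Gamma> where "\<Gamma> = (\<integral>u. \<bar>u\<bar> powr r \<partial>F)"
  have \<Gamma>0: "\<Gamma> \<ge> 0" unfolding \<Gamma>_def by (rule integral_nonneg_AE) simp
  have young: "t\<^sup>2 \<le> 2 / r * t powr r + (1 - 2 / r)" if "t \<ge> 0" for t :: real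
  proof (cases "t = 0")
    case False
    hence t: "t > 0" using that by simp
    have "(t powr r) powr (2 / r) * 1 powr (1 - 2 / r) \<le> 2 / r * t powr r + (1 - 2 / r) * 1"
      using r t by (intro Youngs_inequality_0) auto
    moreover have "(t powr r) powr (2 / r) = t\<^sup>2" using r t by (simp add: powr_powr powr_numeral)
    ultimately show ?thesis by simp
  qed (use r in auto)
  show sq: "integrable F (\<lambda>u. u\<^sup>2)"
  proof (rule Bochner_Integration.integrable_bound)
    show "integrable F (\<lambda>u. 2 / r * \<bar>u\<bar> powr r + (1 - 2 / r))" using int by simp
    show "AE u in F. norm (u\<^sup>2) \<le> norm (2 / r * \<bar>u\<bar> powr r + (1 - 2 / r))"
    proof (rule AE_I2)
      fix u :: real
      show "norm (u\<^sup>2) \<le> norm (2 / r * \<bar>u\<bar> powr r + (1 - 2 / r))"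
        using young[of "\<bar>u\<bar>"] by simp
    qed
  qed measurable
  show "(\<integral>u. u\<^sup>2 \<partial>F) \<le> ((\<integral>u. \<bar>u\<bar> powr r \<partial>F) powr (1 / r))\<^sup>2"
  proof (cases "\<Gamma> = 0")
    case True
    hence "AE u in F. \<bar>u\<bar> powr r = 0"
      unfolding \<Gamma>_def by (subst (asm) integral_nonneg_eq_0_iff_AE[OF int]) auto
    hence "(\<integral>u. u\<^sup>2 \<partial>F) = (\<integral>u. 0 \<partial>F)" by (intro integral_cong_AE) auto
    thus ?thesis by simp
  next
    case False
    define g where "g = \<Gamma> powr (1 / r)"
    have g: "g > 0" "g powr r = \<Gamma>" using False \<Gamma>0 r by (auto simp: g_def powr_powr)
    have "(\<integral>u. u\<^sup>2 \<partial>F) \<le> (\<integral>u. g\<^sup>2 * (2 / r * (\<bar>u\<bar> powr r / \<Gamma>) + (1 - 2 / r)) \<partial>F)"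
    proof (rule integral_mono)
      fix u :: real
      have "(\<bar>u\<bar> / g)\<^sup>2 \<le> 2 / r * (\<bar>u\<bar> / g) powr r + (1 - 2 / r)" using g by (intro young) auto
      also have "(\<bar>u\<bar> / g) powr r = \<bar>u\<bar> powr r / \<Gamma>" using g by (simp add: powr_divide)
      finally have "g\<^sup>2 * (\<bar>u\<bar> / g)\<^sup>2 \<le> g\<^sup>2 * (2 / r * (\<bar>u\<bar> powr r / \<Gamma>) + (1 - 2 / r))"
        by (rule mult_left_mono) simp
      thus "u\<^sup>2 \<le> g\<^sup>2 * (2 / r * (\<bar>u\<bar> powr r / \<Gamma>) + (1 - 2 / r))"
        using g by (simp add: power_divide)
    qed (use sq int in auto)
    also have "\<dots> = g\<^sup>2 * (2 / r * (\<Gamma> / \<Gamma>) + (1 - 2 / r))"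
      using int by (simp add: \<Gamma>_def F.prob_space)
    also have "\<dots> = g\<^sup>2" using False by simp
    finally show ?thesis by (simp add: g_def \<Gamma>_def)
  qed
qed

context iid_sample
begin

lemma linear_combination_second_moment:
  assumes sq: "integrable F (\<lambda>u. u\<^sup>2)" and mean: "(\<integral>u. u \<partial>F) = 0"
  shows "(\<integral>\<^sup>+ \<omega>. ennreal ((\<Sum>i=1..N. a i * e i \<omega>)\<^sup>2) \<partial>M) = ennreal ((\<integral>u. u\<^sup>2 \<partial>F) * (\<Sum>i=1..N. (a i)\<^sup>2))"
proof -
  have ind: "indep_vars (\<lambda>_. borel) (\<lambda>i \<omega>. a i * e i \<omega>) {1..N}"
    by (rule indep_vars_compose2[OF indep]) measurable
  have int: "integrable M (\<lambda>\<omega>. (a i * e i \<omega>)\<^sup>2)" if "i \<in> {1..N}" for i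
    using sq integrable_e[OF that, of "\<lambda>u. u\<^sup>2"] by (simp add: power_mult_distrib)
  have ex: "expectation (\<lambda>\<omega>. a i * e i \<omega>) = 0" if "i \<in> {1..N}" for i
    using mean expectation_e[OF that, of "\<lambda>u. u"] by simp
  have sm: "integrable M (\<lambda>\<omega>. (\<Sum>i=1..N. a i * e i \<omega>)\<^sup>2)"
    "expectation (\<lambda>\<omega>. (\<Sum>i=1..N. a i * e i \<omega>)\<^sup>2) = (\<Sum>i=1..N. expectation (\<lambda>\<omega>. (a i * e i \<omega>)\<^sup>2))"
    by (rule second_moment_indep_sum[OF finite_atLeastAtMost ind int ex]; assumption)+
  have "(\<integral>\<^sup>+ \<omega>. ennreal ((\<Sum>i=1..N. a i * e i \<omega>)\<^sup>2) \<partial>M) = ennreal (expectation (\<lambda>\<omega>. (\<Sum>i=1..N. a i * e i \<omega>)\<^sup>2))"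
    by (intro nn_integral_eq_integral sm(1)) auto
  also have "expectation (\<lambda>\<omega>. (\<Sum>i=1..N. a i * e i \<omega>)\<^sup>2) = (\<Sum>i=1..N. (a i)\<^sup>2 * (\<integral>u. u\<^sup>2 \<partial>F))"
    unfolding sm(2)
    using expectation_e[of _ "\<lambda>u. u\<^sup>2"] by (intro sum.cong) (auto simp: power_mult_distrib)
  also have "\<dots> = (\<integral>u. u\<^sup>2 \<partial>F) * (\<Sum>i=1..N. (a i)\<^sup>2)"
    by (simp add: sum_distrib_left mult.commute)
  finally show ?thesis .
qed

end

section \<open>The finite-sample guarantee\<close>

text \<open>The exceptional events for the core and the tail of the integrated error get probability
  \<open>\<eta> / 9\<close> each, which is \<open>\<eta>' / 3\<close> for \<open>\<eta>' = \<eta> / 3\<close>.  Their bounds are dominated by the second and the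
  third term of \<open>eps1\<close>, and the logarithmic factor is at least \<open>1\<close> because \<open>2 * N + 1 \<ge> exp 1\<close>.\<close>

lemma eps1_lower_bound:
  assumes \<alpha>: "0 < \<alpha>" "\<alpha> < 1" and r: "r > 2" and \<Gamma>: "0 \<le> \<Gamma>" and \<eta>: "0 < \<eta>" "\<eta> < 1" and N: "N \<ge> 1"
  shows "max \<alpha> (1 - \<alpha>) * (sqrt (2 * ln (2 / (\<eta> / 9))) / sqrt (real N) + 4 / (r - 2) * sqrt (\<Gamma> / (\<eta> / 9)) / sqrt (real N))
           \<le> min \<alpha> (1 - \<alpha>) * eps1 d \<alpha> r \<Gamma> \<eta> N"
    and "0 < eps1 d \<alpha> r \<Gamma> \<eta> N"
proof -
  define L m where "L = max \<alpha> (1 - \<alpha>)" and "m = min \<alpha> (1 - \<alpha>)"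
  have Lm: "L > 0" "m > 0" using \<alpha> by (auto simp: L_def m_def)
  define K where "K = 360 * sqrt (real d + 2) + 2 * sqrt (2 * ln (9 / \<eta>)) +
      sqrt (9 * \<Gamma> / \<eta>) * (32 / (r - 2)) * sqrt (ln (72 / \<eta>) + 2 * (real d + 2))"
  define l where "l = ln (2 * real N + 1) powr (1 / r)"
  have eps1: "eps1 d \<alpha> r \<Gamma> \<eta> N = L / m * K * (l / sqrt (real N))"
    by (simp add: eps1_def Let_def K_def l_def loss_ratio_def L_def m_def)
  have "exp 1 \<le> 2 * real N + 1" using exp_le N by linarith
  hence "ln (2 * real N + 1) \<ge> 1" by (subst ln_ge_iff) auto
  hence l: "l \<ge> 1" unfolding l_def using r by (intro ge_one_powr_ge_zero) auto
  have ln9: "ln (9 / \<eta>) \<ge> 0" "ln 2 \<le> ln (9 / \<eta>)" "ln (72 / \<eta>) \<ge> 0"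
    using \<eta> by (auto simp: field_simps)
  have "ln (2 / (\<eta> / 9)) = ln (2 * (9 / \<eta>))" by (rule arg_cong[where f = ln]) simp
  also have "\<dots> = ln 2 + ln (9 / \<eta>)" using \<eta> by (intro ln_mult_pos) auto
  finally have "2 * ln (2 / (\<eta> / 9)) \<le> 4 * (2 * ln (9 / \<eta>))" using ln9 by linarith
  hence "sqrt (2 * ln (2 / (\<eta> / 9))) \<le> sqrt (4 * (2 * ln (9 / \<eta>)))" by (rule real_sqrt_le_mono)
  also have "\<dots> = 2 * sqrt (2 * ln (9 / \<eta>))" by (subst real_sqrt_mult) simp
  finally have a: "sqrt (2 * ln (2 / (\<eta> / 9))) \<le> 2 * sqrt (2 * ln (9 / \<eta>))" .
  have "4 / (r - 2) * sqrt (\<Gamma> / (\<eta> / 9)) = sqrt (9 * \<Gamma> / \<eta>) * (4 / (r - 2)) * 1"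
    by (simp add: mult.commute)
  also have "\<dots> \<le> sqrt (9 * \<Gamma> / \<eta>) * (32 / (r - 2)) * sqrt (ln (72 / \<eta>) + 2 * (real d + 2))"
    using r \<Gamma> \<eta> ln9 by (intro mult_mono divide_right_mono) auto
  finally have b: "4 / (r - 2) * sqrt (\<Gamma> / (\<eta> / 9)) \<le> \<dots>" .
  have c: "0 < 360 * sqrt (real d + 2)" by simp
  define q where "q = sqrt (2 * ln (2 / (\<eta> / 9))) + 4 / (r - 2) * sqrt (\<Gamma> / (\<eta> / 9))"
  have q: "q \<le> K" unfolding q_def K_def using a b c by linarith
  have q0: "0 \<le> q"
    unfolding q_def using r \<Gamma> \<eta> by (intro add_nonneg_nonneg mult_nonneg_nonneg) auto
  have K: "K > 0" unfolding K_def using c ln9 r \<Gamma> \<eta>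
    by (intro add_pos_nonneg mult_nonneg_nonneg) auto
  show "0 < eps1 d \<alpha> r \<Gamma> \<eta> N" unfolding eps1 using Lm K l N by simp
  have "q * 1 \<le> K * l" using q q0 l K by (intro mult_mono) auto
  hence "L * ((q * 1) / sqrt (real N)) \<le> L * ((K * l) / sqrt (real N))"
    using Lm by (intro mult_left_mono divide_right_mono) auto
  also have "\<dots> = m * eps1 d \<alpha> r \<Gamma> \<eta> N" unfolding eps1 using Lm by simp
  finally show "max \<alpha> (1 - \<alpha>) * (sqrt (2 * ln (2 / (\<eta> / 9))) / sqrt (real N) + 4 / (r - 2) * sqrt (\<Gamma> / (\<eta> / 9)) / sqrt (real N))
           \<le> min \<alpha> (1 - \<alpha>) * eps1 d \<alpha> r \<Gamma> \<eta> N"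
    by (simp add: q_def add_divide_distrib L_def m_def)
qed

text \<open>Chebyshev's inequality gives the factor \<open>sqrt (3 / \<eta>)\<close>, which is at most \<open>3 / \<eta>\<close>.\<close>

lemma eps2_lower_bound:
  assumes \<eta>: "0 < \<eta>" "\<eta> < 1"
  shows "\<Gamma> powr (1 / r) * sqrt (real N * real d / (\<eta> / 3)) / real N \<le> eps2 d r \<Gamma> \<eta> N"
proof (cases "N = 0")
  case False
  have "sqrt (3 / \<eta>) * 1 \<le> sqrt (3 / \<eta>) * sqrt (3 / \<eta>)"
    using \<eta> by (intro mult_left_mono) auto
  hence s: "sqrt (3 / \<eta>) \<le> 3 / \<eta>" using \<eta> by simp
  have "sqrt (real N * real d / (\<eta> / 3)) / real N = sqrt (3 / \<eta>) * sqrt (real d / real N)"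
  proof -
    have "sqrt (real N * real d / (\<eta> / 3)) / real N = sqrt (real N * real d / (\<eta> / 3)) / sqrt ((real N)\<^sup>2)"
      by simp
    also have "\<dots> = sqrt (3 / \<eta> * (real d / real N))"
      unfolding real_sqrt_divide[symmetric] using False
      by (intro arg_cong[where f = sqrt]) (simp add: power2_eq_square)
    finally show ?thesis by (simp only: real_sqrt_mult)
  qed
  also have "\<dots> \<le> 3 / \<eta> * sqrt (real d / real N)" using s by (intro mult_right_mono) auto
  finally have "\<Gamma> powr (1 / r) * (sqrt (real N * real d / (\<eta> / 3)) / real N)
      \<le> \<Gamma> powr (1 / r) * (3 / \<eta> * sqrt (real d / real N))"
    by (rule mult_left_mono) simp
  thus ?thesis by (simp add: eps2_def mult_ac)
qed (simp add: eps2_def)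

context iid_sample
begin

text \<open>One lemma for both regression errors: the prediction error at \<open>c\<close> is the case of a single
  combination, the average absolute prediction error at the design points is that of \<open>N\<close>
  combinations.\<close>

lemma linear_combinations_deviation:
  fixes a :: "nat \<Rightarrow> nat \<Rightarrow> real"
  assumes r: "r > 2" and int: "integrable F (\<lambda>u. \<bar>u\<bar> powr r)" and mean: "(\<integral>u. u \<partial>F) = 0"
    and \<Gamma>: "\<Gamma> = (\<integral>u. \<bar>u\<bar> powr r \<partial>F)" and \<delta>: "0 < \<delta>" and K: "finite K"
  obtains A where "A \<in> events" "prob A \<le> \<delta>"
    "\<And>\<omega>. \<omega> \<in> space M - A \<Longrightarrow> (\<Sum>k\<in>K. \<bar>\<Sum>i=1..N. a k i * e i \<omega>\<bar>)
        \<le> \<Gamma> powr (1 / r) * sqrt (real (card K) * (\<Sum>k\<in>K. \<Sum>i=1..N. (a k i)\<^sup>2) / \<delta>)"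
proof -
  define g where "g = \<Gamma> powr (1 / r)"
  define S where "S = (\<Sum>k\<in>K. \<Sum>i=1..N. (a k i)\<^sup>2)"
  have S0: "S \<ge> 0" unfolding S_def by (intro sum_nonneg) auto
  note sm = second_moment_le_moment[OF prob_space_F sets_F r int]
  have g: "(\<integral>u. u\<^sup>2 \<partial>F) \<le> g\<^sup>2" "g \<ge> 0" using sm(2) by (auto simp: g_def \<Gamma>)
  let ?f = "\<lambda>k \<omega>. \<Sum>i=1..N. a k i * e i \<omega>"
  have fm [measurable]: "?f k \<in> borel_measurable M" for k
    using rv_e by (intro borel_measurable_sum borel_measurable_times) auto
  have "(\<integral>\<^sup>+ \<omega>. (\<Sum>k\<in>K. ennreal ((?f k \<omega>)\<^sup>2)) \<partial>M) = (\<Sum>k\<in>K. \<integral>\<^sup>+ \<omega>. ennreal ((?f k \<omega>)\<^sup>2) \<partial>M)"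
    by (rule nn_integral_sum) measurable
  also have "\<dots> = (\<Sum>k\<in>K. ennreal ((\<integral>u. u\<^sup>2 \<partial>F) * (\<Sum>i=1..N. (a k i)\<^sup>2)))"
    by (simp only: linear_combination_second_moment[OF sm(1) mean])
  also have "\<dots> \<le> (\<Sum>k\<in>K. ennreal (g\<^sup>2 * (\<Sum>i=1..N. (a k i)\<^sup>2)))"
    using g by (intro sum_mono ennreal_leI mult_right_mono sum_nonneg) auto
  also have "\<dots> = ennreal (g\<^sup>2 * S)"
    unfolding S_def sum_distrib_left by (intro sum_ennreal sum_nonneg) auto
  also have "g\<^sup>2 * S = \<delta> * (g\<^sup>2 * S / \<delta>)"
    using \<delta> by simp
  finally have le: "(\<integral>\<^sup>+ \<omega>. (\<Sum>k\<in>K. ennreal ((?f k \<omega>)\<^sup>2)) \<partial>M) \<le> ennreal (\<delta> * (g\<^sup>2 * S / \<delta>))" .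
  have meas: "(\<lambda>\<omega>. \<Sum>k\<in>K. ennreal ((?f k \<omega>)\<^sup>2)) \<in> borel_measurable M" by measurable
  have nonneg: "0 \<le> g\<^sup>2 * S / \<delta>" using S0 \<delta> by simp
  obtain A where A: "A \<in> events" "prob A \<le> \<delta>"
      "\<And>\<omega>. \<omega> \<in> space M - A \<Longrightarrow> (\<Sum>k\<in>K. ennreal ((?f k \<omega>)\<^sup>2)) \<le> ennreal (g\<^sup>2 * S / \<delta>)"
    using Markov_exceptional_event[OF meas le nonneg less_imp_le[OF \<delta>]] by blast
  have "(\<Sum>k\<in>K. \<bar>?f k \<omega>\<bar>) \<le> g * sqrt (real (card K) * S / \<delta>)" if \<omega>: "\<omega> \<in> space M - A" for \<omega>
  proof (rule power2_le_imp_le)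
    have "(\<Sum>k\<in>K. (?f k \<omega>)\<^sup>2) \<le> g\<^sup>2 * S / \<delta>"
      using A(3)[OF \<omega>] S0 \<delta> by (simp add: sum_ennreal)
    hence "real (card K) * (\<Sum>k\<in>K. (?f k \<omega>)\<^sup>2) \<le> real (card K) * (g\<^sup>2 * S / \<delta>)"
      by (rule mult_left_mono) simp
    moreover have "(\<Sum>k\<in>K. 1 * \<bar>?f k \<omega>\<bar>)\<^sup>2 \<le> (\<Sum>k\<in>K. 1\<^sup>2) * (\<Sum>k\<in>K. \<bar>?f k \<omega>\<bar>\<^sup>2)"
      by (rule Cauchy_Schwarz_ineq_sum)
    ultimately show "(\<Sum>k\<in>K. \<bar>?f k \<omega>\<bar>)\<^sup>2 \<le> (g * sqrt (real (card K) * S / \<delta>))\<^sup>2"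
      using S0 \<delta> by (simp add: power_mult_distrib mult_ac)
    show "0 \<le> g * sqrt (real (card K) * S / \<delta>)" using g S0 \<delta> by simp
  qed
  with A(1,2) show ?thesis unfolding g_def S_def by (rule that)
qed

lemma risk_le_risk_empirical:
  assumes \<alpha>: "0 < \<alpha>" "\<alpha> < 1" and \<omega>: "\<omega> \<in> space M"
    and core: "(\<integral>\<^sup>+ t. ennreal (cdf_error t \<omega>) * indicator {-1..1} t \<partial>lborel) \<le> ennreal a"
    and tail: "(\<integral>\<^sup>+ t. ennreal (cdf_error t \<omega>) * indicator (- {-1..1}) t \<partial>lborel) \<le> ennreal b"
    and ab: "0 \<le> a" "0 \<le> b"
  shows "risk \<alpha> s F \<le> risk \<alpha> s (empirical N (\<lambda>i. e i \<omega>)) + ennreal (max \<alpha> (1 - \<alpha>) * (a + b))"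
proof -
  let ?L = "max \<alpha> (1 - \<alpha>)"
  let ?G = "empirical N (\<lambda>i. e i \<omega>)"
  have [measurable]: "(\<lambda>t. cdf_error t \<omega>) \<in> borel_measurable borel"
    using measurable_Pair1[OF cdf_error_measurable, of \<omega>] \<omega> by (simp add: measurable_lborel2)
  have "risk \<alpha> s F \<le> risk \<alpha> s ?G + ennreal ?L * (\<integral>\<^sup>+ t. ennreal \<bar>measure ?G {..t} - measure F {..t}\<bar> \<partial>lborel)"
    by (rule risk_le_risk_plus_cdf_distance[OF \<alpha> prob_space_F sets_F prob_space_empirical sets_empirical])
  also have "(\<integral>\<^sup>+ t. ennreal \<bar>measure ?G {..t} - measure F {..t}\<bar> \<partial>lborel) = (\<integral>\<^sup>+ t. ennreal (cdf_error t \<omega>) \<partial>lborel)"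
    by (simp only: measure_empirical_atMost[OF N_pos] cdf_error_def)
  also have "\<dots> = (\<integral>\<^sup>+ t. ennreal (cdf_error t \<omega>) * indicator {-1..1} t
        + ennreal (cdf_error t \<omega>) * indicator (- {-1..1}) t \<partial>lborel)"
    by (intro nn_integral_cong) (auto simp: indicator_def)
  also have "\<dots> = (\<integral>\<^sup>+ t. ennreal (cdf_error t \<omega>) * indicator {-1..1} t \<partial>lborel)
        + (\<integral>\<^sup>+ t. ennreal (cdf_error t \<omega>) * indicator (- {-1..1}) t \<partial>lborel)"
    by (rule nn_integral_add) measurable
  also have "risk \<alpha> s ?G + ennreal ?L * \<dots> \<le> risk \<alpha> s ?G + ennreal ?L * (ennreal a + ennreal b)"
    by (intro add_left_mono mult_left_mono add_mono core tail) simp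
  also have "ennreal ?L * (ennreal a + ennreal b) = ennreal (?L * (a + b))"
    using \<alpha> ab by (subst ennreal_mult) auto
  finally show ?thesis .
qed

end

theorem theorem4:
  fixes M :: "'a measure"
    and Fstar :: "real measure"
    and e y :: "nat \<Rightarrow> 'a \<Rightarrow> real"
    and x :: "nat \<Rightarrow> real ^ 'd"
    and \<beta> c :: "real ^ 'd"
    and \<alpha> r \<eta> \<Gamma>\<^sub>0 :: real
    and p :: ennreal
  assumes "prob_space M"
    and "prob_space.indep_vars M (\<lambda>_. borel) e {1..}"
    and "\<And>i. i \<ge> 1 \<Longrightarrow> distr M borel (e i) = Fstar"
    and "\<And>i \<omega>. i \<ge> 1 \<Longrightarrow> \<omega> \<in> space M \<Longrightarrow> y i \<omega> = \<beta> \<bullet> x i + e i \<omega>"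
    and "(\<integral>u. u \<partial>Fstar) = 0"
    and "0 < \<alpha>" and "\<alpha> < 1"
    and "1 \<le> p"
    and "\<exists>Q. (\<lambda>N. (1 / real N) *\<^sub>R gram x N) \<longlonglongrightarrow> Q \<and> invertible Q"
    and "r > 2"
    and "integrable Fstar (\<lambda>u. \<bar>u\<bar> powr r)"
    and "\<Gamma>\<^sub>0 = (\<integral>u. \<bar>u\<bar> powr r \<partial>Fstar)"
    and "0 < \<eta>" and "\<eta> < 1"
  shows "(\<forall>N \<ge> 1. \<forall>s_hat :: 'a \<Rightarrow> real.
            dim (x ` {1..N}) = CARD('d) \<longrightarrow>
            s_hat \<in> borel_measurable M \<longrightarrow>
            (\<forall>\<omega> \<in> space M. is_arg_min
               (worst_case_risk \<alpha> p (empirical N (residual x (\<lambda>i. y i \<omega>) N))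
                  (eps x c \<alpha> r \<Gamma>\<^sub>0 \<eta> N))
               (\<lambda>s. True) (s_hat \<omega>)) \<longrightarrow>
            measure M {\<omega> \<in> space M.
               risk \<alpha> (s_hat \<omega>) (target_dist Fstar \<beta> (ols x (\<lambda>i. y i \<omega>) N) c)
               \<le> worst_case_risk \<alpha> p (empirical N (residual x (\<lambda>i. y i \<omega>) N))
                    (eps x c \<alpha> r \<Gamma>\<^sub>0 \<eta> N) (s_hat \<omega>)} \<ge> 1 - \<eta>)
         \<and> (\<lambda>N. eps3 x c r \<Gamma>\<^sub>0 \<eta> N) \<in> O(\<lambda>N. 1 / sqrt (real N))"
proof (intro conjI allI impI)
  show "(\<lambda>N. eps3 x c r \<Gamma>\<^sub>0 \<eta> N) \<in> O(\<lambda>N. 1 / sqrt (real N))"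
    using assms(9,13) eps3_bigo by blast
next
  fix N :: nat and s_hat :: "'a \<Rightarrow> real"
  assume N: "N \<ge> 1" and full: "dim (x ` {1..N}) = CARD('d)"
    and s_meas [measurable]: "s_hat \<in> borel_measurable M"
  note \<alpha> = \<open>0 < \<alpha>\<close> \<open>\<alpha> < 1\<close> and p = \<open>1 \<le> p\<close> and r = \<open>r > 2\<close> and int = assms(11)
    and \<Gamma> = \<open>\<Gamma>\<^sub>0 = _\<close> and \<eta> = \<open>0 < \<eta>\<close> \<open>\<eta> < 1\<close> and mean = assms(5)
  interpret prob_space M by fact
  interpret iid_sample M e Fstar N
  proof unfold_locales
    show "indep_vars (\<lambda>_. borel) e {1..N}"
      using assms(2) by (rule indep_vars_subset) auto
  qed (use assms(3) N in auto)
  have \<Gamma>0: "0 \<le> \<Gamma>\<^sub>0" unfolding \<Gamma> by (rule integral_nonneg_AE) simp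
  have inv: "invertible (gram x N)" using full by (rule invertible_gram)
  let ?H = "matrix_inv (gram x N)"
  define L m where "L = max \<alpha> (1 - \<alpha>)" and "m = min \<alpha> (1 - \<alpha>)"
  have Lm: "0 < L" "0 < m" using \<alpha> by (auto simp: L_def m_def)
  define \<epsilon> where "\<epsilon> = eps x c \<alpha> r \<Gamma>\<^sub>0 \<eta> N"
  define b where "b = (\<lambda>\<omega>. ols x (\<lambda>i. y i \<omega>) N)"
  define z where "z = (\<lambda>\<omega>. residual x (\<lambda>i. y i \<omega>) N)"
  have err: "(\<beta> - b \<omega>) \<bullet> v = - (\<Sum>i=1..N. (x i \<bullet> (?H *v v)) * e i \<omega>)" if "\<omega> \<in> space M" for \<omega> v
    using ols_error[OF inv, of "\<lambda>i. y i \<omega>" \<beta> "\<lambda>i. e i \<omega>" v] assms(4) that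
    by (simp add: b_def inner_diff_left)
  have z_eq: "z \<omega> i = e i \<omega> + (\<beta> - b \<omega>) \<bullet> x i" if "\<omega> \<in> space M" "i \<in> {1..N}" for \<omega> i
    using assms(4)[of i \<omega>] that by (simp add: z_def residual_def b_def inner_diff_left)
  have err_meas: "(\<lambda>\<omega>. (\<beta> - b \<omega>) \<bullet> v) \<in> borel_measurable M" for v
  proof -
    have "(\<lambda>\<omega>. - (\<Sum>i=1..N. (x i \<bullet> (?H *v v)) * e i \<omega>)) \<in> borel_measurable M"
      using rv_e by (intro borel_measurable_uminus borel_measurable_sum borel_measurable_times) auto
    thus ?thesis by (subst measurable_cong[OF err]) auto
  qed
  have lev: "(\<Sum>i=1..N. (x i \<bullet> (?H *v v))\<^sup>2) = v \<bullet> (?H *v v)" for v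
    by (rule ols_weights_norm[OF inv])

  have e1: "0 < eps1 CARD('d) \<alpha> r \<Gamma>\<^sub>0 \<eta> N"
    by (rule eps1_lower_bound(2)[OF \<alpha> r \<Gamma>0 \<eta> N])
  have cHc: "0 \<le> c \<bullet> (?H *v c)" unfolding lev[symmetric] by (intro sum_nonneg) auto
  have e23: "0 \<le> eps2 CARD('d) r \<Gamma>\<^sub>0 \<eta> N" "0 \<le> eps3 x c r \<Gamma>\<^sub>0 \<eta> N"
    using \<eta> cHc by (auto simp: eps2_def eps3_def intro!: mult_nonneg_nonneg)
  have \<epsilon>_eq: "\<epsilon> * m = m * eps1 CARD('d) \<alpha> r \<Gamma>\<^sub>0 \<eta> N + L * (eps2 CARD('d) r \<Gamma>\<^sub>0 \<eta> N + eps3 x c r \<Gamma>\<^sub>0 \<eta> N)"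
    using Lm by (simp add: \<epsilon>_def eps_def loss_ratio_def algebra_simps flip: L_def m_def)
  have \<epsilon>: "0 < \<epsilon>"
    unfolding \<epsilon>_def eps_def loss_ratio_def L_def[symmetric] m_def[symmetric] using e1 e23 Lm
    by (intro add_pos_nonneg mult_nonneg_nonneg) auto

  \<comment> \<open>The four exceptional events have total probability \<open>2 * \<eta> / 9 + 2 * \<eta> / 3\<close>, which is less than \<open>\<eta>\<close>.\<close>
  obtain A1 where A1: "A1 \<in> events" "prob A1 \<le> \<eta> / 9"
    "\<And>\<omega>. \<omega> \<in> space M - A1 \<Longrightarrow> (\<integral>\<^sup>+ t. ennreal (cdf_error t \<omega>) * indicator {-1..1} t \<partial>lborel)
        \<le> ennreal (sqrt (2 * ln (2 / (\<eta> / 9))) / sqrt (real N))"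
    using cdf_error_core_le[of "\<eta> / 9"] \<eta> by auto
  obtain A2 where A2: "A2 \<in> events" "prob A2 \<le> \<eta> / 9"
    "\<And>\<omega>. \<omega> \<in> space M - A2 \<Longrightarrow> (\<integral>\<^sup>+ t. ennreal (cdf_error t \<omega>) * indicator (- {-1..1}) t \<partial>lborel)
        \<le> ennreal (4 / (r - 2) * sqrt (\<Gamma>\<^sub>0 / (\<eta> / 9)) / sqrt (real N))"
    using cdf_error_tail_le[of "\<eta> / 9" r \<Gamma>\<^sub>0] \<eta> r int \<Gamma> by auto
  obtain A3 where A3: "A3 \<in> events" "prob A3 \<le> \<eta> / 3"
    "\<And>\<omega>. \<omega> \<in> space M - A3 \<Longrightarrow> (\<Sum>k\<in>{1..N}. \<bar>\<Sum>i=1..N. (x i \<bullet> (?H *v x k)) * e i \<omega>\<bar>)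
        \<le> \<Gamma>\<^sub>0 powr (1 / r) * sqrt (real (card {1..N}) * (\<Sum>k\<in>{1..N}. \<Sum>i=1..N. (x i \<bullet> (?H *v x k))\<^sup>2) / (\<eta> / 3))"
    using linear_combinations_deviation[OF r int mean \<Gamma>, of "\<eta> / 3" "{1..N}" "\<lambda>k i. x i \<bullet> (?H *v x k)"] \<eta> by auto
  obtain A4 where A4: "A4 \<in> events" "prob A4 \<le> \<eta> / 3"
    "\<And>\<omega>. \<omega> \<in> space M - A4 \<Longrightarrow> (\<Sum>k\<in>{0::nat}. \<bar>\<Sum>i=1..N. (x i \<bullet> (?H *v c)) * e i \<omega>\<bar>)
        \<le> \<Gamma>\<^sub>0 powr (1 / r) * sqrt (real (card {0::nat}) * (\<Sum>k\<in>{0::nat}. \<Sum>i=1..N. (x i \<bullet> (?H *v c))\<^sup>2) / (\<eta> / 3))"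
    using linear_combinations_deviation[OF r int mean \<Gamma>, of "\<eta> / 3" "{0}" "\<lambda>k i. x i \<bullet> (?H *v c)"] \<eta> by auto

  \<comment> \<open>The inequality on the good event holds for every \<open>s\<close>, in particular for the estimated one.\<close>
  have good: "risk \<alpha> s (target_dist Fstar \<beta> (b \<omega>) c) \<le> worst_case_risk \<alpha> p (empirical N (z \<omega>)) \<epsilon> s"
    if \<omega>: "\<omega> \<in> space M" "\<omega> \<notin> A1" "\<omega> \<notin> A2" "\<omega> \<notin> A3" "\<omega> \<notin> A4" for \<omega> s
  proof -
    define q1 where "q1 = sqrt (2 * ln (2 / (\<eta> / 9))) / sqrt (real N)"
    define q2 where "q2 = 4 / (r - 2) * sqrt (\<Gamma>\<^sub>0 / (\<eta> / 9)) / sqrt (real N)"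
    have q: "0 \<le> q1" "0 \<le> q2" using r \<Gamma>0 \<eta> by (auto simp: q1_def q2_def)
    have d3: "\<bar>(\<beta> - b \<omega>) \<bullet> c\<bar> \<le> eps3 x c r \<Gamma>\<^sub>0 \<eta> N"
      using A4(3)[of \<omega>] \<omega> err[of \<omega> c] lev[of c] by (simp add: eps3_def mult.commute)
    have "(\<Sum>i=1..N. \<bar>e i \<omega> - z \<omega> i\<bar>) = (\<Sum>k\<in>{1..N}. \<bar>\<Sum>i=1..N. (x i \<bullet> (?H *v x k)) * e i \<omega>\<bar>)"
      using \<omega> by (intro sum.cong) (auto simp: z_eq err)
    also have "\<dots> \<le> \<Gamma>\<^sub>0 powr (1 / r) * sqrt (real N * real CARD('d) / (\<eta> / 3))"
    proof -
      have "(\<Sum>k\<in>{1..N}. \<Sum>i=1..N. (x i \<bullet> (?H *v x k))\<^sup>2) = real CARD('d)"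
        by (simp only: lev ols_leverage_sum[OF inv])
      with A3(3)[of \<omega>] \<omega> show ?thesis by simp
    qed
    finally have "(\<Sum>i=1..N. \<bar>e i \<omega> - z \<omega> i\<bar>) / real N
        \<le> \<Gamma>\<^sub>0 powr (1 / r) * sqrt (real N * real CARD('d) / (\<eta> / 3)) / real N"
      by (rule divide_right_mono) simp
    also have "\<dots> \<le> eps2 CARD('d) r \<Gamma>\<^sub>0 \<eta> N" by (rule eps2_lower_bound[OF \<eta>])
    finally have d2: "(\<Sum>i=1..N. \<bar>e i \<omega> - z \<omega> i\<bar>) / real N \<le> eps2 CARD('d) r \<Gamma>\<^sub>0 \<eta> N" .
    have d1: "L * (q1 + q2) \<le> m * eps1 CARD('d) \<alpha> r \<Gamma>\<^sub>0 \<eta> N"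
      unfolding L_def m_def q1_def q2_def by (rule eps1_lower_bound(1)[OF \<alpha> r \<Gamma>0 \<eta> N])
    have "risk \<alpha> s (target_dist Fstar \<beta> (b \<omega>) c) \<le> risk \<alpha> s Fstar + ennreal (L * \<bar>(\<beta> - b \<omega>) \<bullet> c\<bar>)"
      unfolding L_def by (rule risk_target_le[OF \<alpha> prob_space_F sets_F])
    also have "risk \<alpha> s Fstar \<le> risk \<alpha> s (empirical N (\<lambda>i. e i \<omega>)) + ennreal (L * (q1 + q2))"
      unfolding L_def using A1(3)[of \<omega>] A2(3)[of \<omega>] \<omega> q
      by (intro risk_le_risk_empirical[OF \<alpha>]) (auto simp: q1_def q2_def)
    also have "risk \<alpha> s (empirical N (\<lambda>i. e i \<omega>)) \<le> risk \<alpha> s (empirical N (z \<omega>))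
        + ennreal (L * ((\<Sum>i=1..N. \<bar>e i \<omega> - z \<omega> i\<bar>) / real N))"
      unfolding L_def by (rule risk_empirical_perturb[OF \<alpha> N])
    also have "risk \<alpha> s (empirical N (z \<omega>)) + ennreal (L * ((\<Sum>i=1..N. \<bar>e i \<omega> - z \<omega> i\<bar>) / real N))
        + ennreal (L * (q1 + q2)) + ennreal (L * \<bar>(\<beta> - b \<omega>) \<bullet> c\<bar>)
        = risk \<alpha> s (empirical N (z \<omega>)) + ennreal (L * ((\<Sum>i=1..N. \<bar>e i \<omega> - z \<omega> i\<bar>) / real N)
            + L * (q1 + q2) + L * \<bar>(\<beta> - b \<omega>) \<bullet> c\<bar>)"
      using Lm q by (simp add: ennreal_plus sum_nonneg add.assoc)
    also have "\<dots> \<le> risk \<alpha> s (empirical N (z \<omega>)) + ennreal (\<epsilon> * m)"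
    proof (intro add_left_mono ennreal_leI)
      have "L * ((\<Sum>i=1..N. \<bar>e i \<omega> - z \<omega> i\<bar>) / real N) \<le> L * eps2 CARD('d) r \<Gamma>\<^sub>0 \<eta> N"
        "L * \<bar>(\<beta> - b \<omega>) \<bullet> c\<bar> \<le> L * eps3 x c r \<Gamma>\<^sub>0 \<eta> N"
        by (rule mult_left_mono[OF d2] mult_left_mono[OF d3]; use Lm in simp)+
      thus "L * ((\<Sum>i=1..N. \<bar>e i \<omega> - z \<omega> i\<bar>) / real N) + L * (q1 + q2) + L * \<bar>(\<beta> - b \<omega>) \<bullet> c\<bar> \<le> \<epsilon> * m"
        using d1 unfolding \<epsilon>_eq distrib_left by linarith
    qed
    also have "\<dots> \<le> worst_case_risk \<alpha> p (empirical N (z \<omega>)) \<epsilon> s"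
      unfolding m_def using \<epsilon> by (intro worst_case_risk_ge_risk_empirical[OF \<alpha> p _ N]) simp
    finally show ?thesis by (simp add: add_right_mono)
  qed

  \<comment> \<open>The event contains the good event, but it has to be measurable for its measure to inherit the bound.\<close>
  define S where "S = {\<omega> \<in> space M. risk \<alpha> (s_hat \<omega>) (target_dist Fstar \<beta> (b \<omega>) c)
      \<le> worst_case_risk \<alpha> p (empirical N (z \<omega>)) \<epsilon> (s_hat \<omega>)}"
  have "(\<lambda>\<omega>. worst_case_risk \<alpha> p (empirical N (z \<omega>)) \<epsilon> (s_hat \<omega>)) \<in> borel_measurable M"
  proof (rule worst_case_risk_measurable[OF \<alpha> p \<epsilon> N _ s_meas])
    fix i assume i: "i \<in> {1..N}"
    have "(\<lambda>\<omega>. e i \<omega> + (\<beta> - b \<omega>) \<bullet> x i) \<in> borel_measurable M"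
      using rv_e[OF i] err_meas by (rule borel_measurable_add)
    thus "(\<lambda>\<omega>. z \<omega> i) \<in> borel_measurable M"
      using i by (subst measurable_cong[OF z_eq]) auto
  qed
  moreover have "(\<lambda>\<omega>. risk \<alpha> (s_hat \<omega>) (target_dist Fstar \<beta> (b \<omega>) c)) \<in> borel_measurable M"
  proof -
    interpret F: prob_space Fstar by (rule prob_space_F)
    note [measurable] = err_meas[of c]
    have "risk \<alpha> (s_hat \<omega>) (target_dist Fstar \<beta> (b \<omega>) c)
        = (\<integral>\<^sup>+ u. ennreal (check_loss \<alpha> (u + (\<beta> - b \<omega>) \<bullet> c - s_hat \<omega>)) \<partial>Fstar)" for \<omega>
      unfolding target_dist_def by (rule risk_distr) measurable
    moreover have "(\<lambda>\<omega>. \<integral>\<^sup>+ u. ennreal (check_loss \<alpha> (u + (\<beta> - b \<omega>) \<bullet> c - s_hat \<omega>)) \<partial>Fstar) \<in> borel_measurable M"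
      by (rule F.borel_measurable_nn_integral) measurable
    ultimately show ?thesis by simp
  qed
  ultimately have S: "S \<in> events" unfolding S_def by measurable
  have "space M - (A1 \<union> A2 \<union> (A3 \<union> A4)) \<subseteq> S" using good by (auto simp: S_def)
  hence "prob (space M - (A1 \<union> A2 \<union> (A3 \<union> A4))) \<le> prob S"
    using S by (rule finite_measure_mono)
  moreover have "prob (space M - (A1 \<union> A2 \<union> (A3 \<union> A4))) = 1 - prob (A1 \<union> A2 \<union> (A3 \<union> A4))"
    using A1(1) A2(1) A3(1) A4(1) by (intro prob_compl) auto
  moreover have "prob (A1 \<union> A2 \<union> (A3 \<union> A4)) \<le> prob A1 + prob A2 + (prob A3 + prob A4)"
    using measure_Un_le[of "A1 \<union> A2" M "A3 \<union> A4"] measure_Un_le[of A1 M A2] measure_Un_le[of A3 M A4]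
      A1(1) A2(1) A3(1) A4(1) by simp
  ultimately have "1 - \<eta> \<le> prob S" using A1(2) A2(2) A3(2) A4(2) \<eta> by linarith
  thus "measure M {\<omega> \<in> space M.
               risk \<alpha> (s_hat \<omega>) (target_dist Fstar \<beta> (ols x (\<lambda>i. y i \<omega>) N) c)
               \<le> worst_case_risk \<alpha> p (empirical N (residual x (\<lambda>i. y i \<omega>) N))
                    (eps x c \<alpha> r \<Gamma>\<^sub>0 \<eta> N) (s_hat \<omega>)} \<ge> 1 - \<eta>"
    by (simp only: S_def b_def z_def \<epsilon>_def)
qed

end
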